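(* There is a strongly polynomial time algorithm that, given as input (the rational coefficients of) a univariate polynomial matrix $P(t)$ with values in the real symmetric $n\times n$ matrices, decides whether $\bigcap_{t\in[-1,1]}\mathrm{Ker}(P(t))=\{0\}$.
   Context: A univariate polynomial matrix $P(t)=P_0+P_1t+\dots+P_dt^d$ (with each $P_i$ a real symmetric $n\times n$ matrix) is a matrix whose entries are polynomials in the single variable $t$; $\mathrm{Ker}(M)$ denotes the kernel of the matrix $M$. Computation is in the Turing model. The input consists of the rational coefficients of the entries of $P(t)$, so the dimension of the input is the total number of coefficients, $\binom{n+1}{2}(d+1)$; its encoding length is the number of bits needed to write it in binary. A strongly polynomial time algorithm is one such that (i) it consists of the elementary arithmetic operations addition, subtraction, comparison, multiplication and division; (ii) the number of elementary operations is bounded by a polynomial in the dimension of the input; and (iii) the encoding length of the numbers occurring during the algorithm is bounded by a polynomial function of the encoding length of the input. *)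

theory Defs
  imports
    "Jordan_Normal_Form.Matrix_Kernel"
    "HOL-Computational_Algebra.Polynomial"
    "HOL-Library.Log_Nat"
begin

section \<open>Random access machines with exact rational arithmetic\<close>

text \<open>
  A state consists of registers, which instructions name literally, and a memory, which is
  reached only by indirect addressing.  Both hold rational numbers, so loop counters and
  addresses are computed with the same elementary operations as everything else, and their
  operations and encoding lengths are accounted for in the same way.
\<close>

type_synonym state = "(nat \<Rightarrow> rat) \<times> (nat \<Rightarrow> rat)"

datatype instr =
    Const nat rat
  | Move nat nat
  | Add nat nat nat
  | Sub nat nat nat
  | Mul nat nat nat
  | Div nat nat nat
  | Load nat nat
  | Store nat nat

datatype test = Less nat nat | Eq nat nat

datatype com = Skip | Instr instr | Seq com com | If test com com | While test com

text \<open>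
  Division by zero and addresses that are not natural numbers have no result, so no rounding
  operation and no convention for \<open>x / 0\<close> is available to a program.
\<close>

fun exec_instr :: "instr \<Rightarrow> state \<Rightarrow> state option" where
  "exec_instr (Const i q) (r, m) = Some (r(i := q), m)"
| "exec_instr (Move i j) (r, m) = Some (r(i := r j), m)"
| "exec_instr (Add i j k) (r, m) = Some (r(i := r j + r k), m)"
| "exec_instr (Sub i j k) (r, m) = Some (r(i := r j - r k), m)"
| "exec_instr (Mul i j k) (r, m) = Some (r(i := r j * r k), m)"
| "exec_instr (Div i j k) (r, m) = (if r k = 0 then None else Some (r(i := r j / r k), m))"
| "exec_instr (Load i a) (r, m) =
     (if r a \<in> \<nat> then Some (r(i := m (nat \<lfloor>r a\<rfloor>)), m) else None)"
| "exec_instr (Store a j) (r, m) =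
     (if r a \<in> \<nat> then Some (r, m(nat \<lfloor>r a\<rfloor> := r j)) else None)"

fun holds :: "test \<Rightarrow> state \<Rightarrow> bool" where
  "holds (Less i j) (r, m) \<longleftrightarrow> r i < r j"
| "holds (Eq i j) (r, m) \<longleftrightarrow> r i = r j"

text \<open>
  \<open>run c s ss s'\<close>: started in \<open>s\<close>, the program \<open>c\<close> halts in \<open>s'\<close>, and \<open>ss\<close> lists the states in
  which its elementary operations (instructions and comparisons) are carried out, one entry
  for each operation.
\<close>

inductive run :: "com \<Rightarrow> state \<Rightarrow> state list \<Rightarrow> state \<Rightarrow> bool" where
  run_Skip: "run Skip s [] s"
| run_Instr: "exec_instr a s = Some s' \<Longrightarrow> run (Instr a) s [s] s'"
| run_Seq: "run c1 s ss1 s1 \<Longrightarrow> run c2 s1 ss2 s2 \<Longrightarrow> run (Seq c1 c2) s (ss1 @ ss2) s2"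
| run_IfTrue: "holds b s \<Longrightarrow> run c1 s ss s' \<Longrightarrow> run (If b c1 c2) s (s # ss) s'"
| run_IfFalse: "\<not> holds b s \<Longrightarrow> run c2 s ss s' \<Longrightarrow> run (If b c1 c2) s (s # ss) s'"
| run_WhileFalse: "\<not> holds b s \<Longrightarrow> run (While b c) s [s] s"
| run_WhileTrue: "holds b s \<Longrightarrow> run c s ss1 s1 \<Longrightarrow> run (While b c) s1 ss2 s2 \<Longrightarrow>
    run (While b c) s (s # ss1 @ ss2) s2"

inductive_cases run_SkipE: "run Skip s ss s'"
inductive_cases run_InstrE: "run (Instr a) s ss s'"
inductive_cases run_SeqE: "run (Seq c1 c2) s ss s'"
inductive_cases run_IfE: "run (If b c1 c2) s ss s'"
inductive_cases run_WhileE: "run (While b c) s ss s'"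

lemma run_deterministic:
  "run c s ss s' \<Longrightarrow> run c s tt t' \<Longrightarrow> tt = ss \<and> t' = s'"
proof (induction arbitrary: tt t' rule: run.induct)
  case (run_Skip s)
  then show ?case by (auto elim: run_SkipE)
next
  case (run_Instr a s s')
  from run_Instr.prems show ?case by (rule run_InstrE) (use run_Instr.hyps in auto)
next
  case (run_Seq c1 s ss1 s1 c2 ss2 s2)
  from run_Seq.prems show ?case by (rule run_SeqE) (use run_Seq.IH in blast)
next
  case (run_IfTrue b s c1 ss s' c2)
  from run_IfTrue.prems show ?case by (rule run_IfE) (use run_IfTrue.IH run_IfTrue.hyps in blast)+
next
  case (run_IfFalse b s c2 ss s' c1)
  from run_IfFalse.prems show ?case by (rule run_IfE) (use run_IfFalse.IH run_IfFalse.hyps in blast)+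
next
  case (run_WhileFalse b s c)
  from run_WhileFalse.prems show ?case by (rule run_WhileE) (use run_WhileFalse.hyps in blast)+
next
  case (run_WhileTrue b s c ss1 s1 ss2 s2)
  from run_WhileTrue.prems show ?case
    by (rule run_WhileE) (use run_WhileTrue.IH run_WhileTrue.hyps in blast)+
qed


section \<open>Strongly polynomial time decision algorithms\<close>

text \<open>
  Bits for a sign, a numerator and a denominator in lowest terms: for a natural number \<open>k\<close>,
  \<open>floorlog 2 k\<close> is the number of binary digits of \<open>k\<close>.
\<close>

definition enc_length :: "rat \<Rightarrow> nat" where
  "enc_length q = (case quotient_of q of (a, b) \<Rightarrow>
     1 + floorlog 2 (nat \<bar>a\<bar>) + floorlog 2 (nat b))"

definition numbers_in :: "state \<Rightarrow> rat set" where
  "numbers_in s = range (fst s) \<union> range (snd s)"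

text \<open>
  The format parameters \<open>ns\<close> of the input (how many numbers there are and how they are arranged)
  are given in the first registers, the input numbers \<open>xs\<close> in the first memory cells.
\<close>

definition initial_state :: "nat list \<Rightarrow> rat list \<Rightarrow> state" where
  "initial_state ns xs =
     ((\<lambda>i. if i < length ns then of_nat (ns ! i) else 0),
      (\<lambda>a. if a < length xs then xs ! a else 0))"

text \<open>
  The program \<open>c\<close> decides \<open>Q\<close> on the instances in \<open>I\<close>, leaving the answer in register 0.  The
  dimension of an input is the number of its entries; the format parameters count neither towards
  the dimension nor towards the encoding length of the input.
\<close>

definition decides_in_strongly_polynomial_time ::
  "com \<Rightarrow> 'i set \<Rightarrow> ('i \<Rightarrow> nat list) \<Rightarrow> ('i \<Rightarrow> rat list) \<Rightarrow> ('i \<Rightarrow> bool) \<Rightarrow> bool" where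
  "decides_in_strongly_polynomial_time c I format entries Q \<longleftrightarrow>
     (\<exists>p q :: nat poly. \<forall>x\<in>I. \<exists>ss s'.
        run c (initial_state (format x) (entries x)) ss s' \<and>
        fst s' 0 = (if Q x then 1 else 0) \<and>
        length ss \<le> poly p (length (entries x)) \<and>
        (\<forall>s \<in> set ss \<union> {s'}. \<forall>y \<in> numbers_in s.
           enc_length y \<le> poly q (\<Sum>z\<leftarrow>entries x. enc_length z)))"


section \<open>Univariate symmetric polynomial matrices\<close>

text \<open>
  \<open>(n, d, P)\<close> stands for \<open>P(t) = P\<^sub>0 + P\<^sub>1 t + \<dots> + P\<^sub>d t^d\<close> with symmetric \<open>n \<times> n\<close> matrices
  \<open>P\<^sub>i\<close>; the leading coefficient \<open>P\<^sub>d\<close> may vanish.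
\<close>

definition sym_poly_matrices :: "(nat \<times> nat \<times> rat poly mat) set" where
  "sym_poly_matrices = {(n, d, P). 1 \<le> n \<and> P \<in> carrier_mat n n \<and> transpose_mat P = P \<and>
     (\<forall>i<n. \<forall>j<n. degree (P $$ (i, j)) \<le> d)}"

fun sizes :: "nat \<times> nat \<times> rat poly mat \<Rightarrow> nat list" where
  "sizes (n, d, P) = [n, d]"

text \<open>Because of symmetry only the entries on and above the diagonal are part of the input.\<close>

fun coefficients :: "nat \<times> nat \<times> rat poly mat \<Rightarrow> rat list" where
  "coefficients (n, d, P) =
     [coeff (P $$ (i, j)) k. j \<leftarrow> [0..<n], i \<leftarrow> [0..<Suc j], k \<leftarrow> [0..<Suc d]]"

lemma length_coefficients: "length (coefficients (n, d, P)) = ((n + 1) choose 2) * (d + 1)"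
proof (induction n)
  case 0
  then show ?case by (simp add: numeral_2_eq_2)
next
  case (Suc n)
  have "length (coefficients (Suc n, d, P)) = length (coefficients (n, d, P)) + Suc n * (d + 1)"
    by (simp add: length_concat comp_def sum_list_triv del: upt_Suc)
       (simp add: length_concat comp_def sum_list_triv)
  then show ?case using Suc.IH by (simp add: numeral_2_eq_2 algebra_simps)
qed

definition eval_poly_mat :: "rat poly mat \<Rightarrow> real \<Rightarrow> real mat" where
  "eval_poly_mat P t = map_mat (\<lambda>f. poly (map_poly of_rat f) t) P"

end

theory Submission
  imports Defs "Jordan_Normal_Form.Schur_Decomposition"
begin

text \<open>
  Write \<open>P(t) = P\<^sub>0 + \<dots> + P\<^sub>d t^d\<close>.  A polynomial that vanishes on an interval is zero, so a real
  vector lies in all the kernels \<open>Ker P(t)\<close> with \<open>t \<in> [-1,1]\<close> iff it lies in all the kernels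
  \<open>Ker P\<^sub>k\<close>.  Since the \<open>P\<^sub>k\<close> are symmetric, \<open>A = P\<^sub>0\<^sup>2 + \<dots> + P\<^sub>d\<^sup>2\<close> satisfies
  \<open>x\<^sup>T A x = \<Sum>\<^sub>k |P\<^sub>k x|\<^sup>2\<close>, and the intersection of these kernels is the kernel of the single
  rational matrix \<open>A\<close> (\<open>common_kernel_trivial_iff\<close>).  It remains to decide whether \<open>det A \<noteq> 0\<close>.

  Gaussian elimination would do, but bounding its intermediate numbers needs the theory of
  minors.  The recursion of Faddeev and LeVerrier,
  \<open>N\<^sub>0 = A\<close>, \<open>c\<^sub>k = - tr N\<^sub>k / (k + 1)\<close>, \<open>N\<^bsub>k+1\<^esub> = A N\<^sub>k + c\<^sub>k A\<close>,
  avoids this: it never searches for a pivot, its only divisors are the integers \<open>1, \<dots>, n\<close>,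
  and \<open>c\<^bsub>n-1\<^esub> = \<plusminus> det A\<close>.  The last fact (\<open>leverrier_coeff_eq_0_iff\<close>) is Newton's identity
  between the power sums of the eigenvalues and their elementary symmetric functions; it is proved
  on a complex triangular matrix similar to \<open>A\<close>.

  The sizes of the numbers follow from the recursion by plain induction.  If \<open>E\<close> is a common
  denominator of the entries of \<open>A\<close> and \<open>b\<close> bounds them, then \<open>E^(k+1) k!\<close> is a common
  denominator of the entries of \<open>N\<^sub>k\<close> (\<open>leverrier_clears\<close>) and \<open>b (2 n b)^k\<close> bounds them
  (\<open>abs_leverrier_le\<close>).  Both have a number of bits that is polynomial in the encoding length
  of the input.

  The program appends \<open>A = N\<^sub>0, N\<^sub>1, \<dots>, N\<^sub>n\<close> to the input in memory and overwrites nothing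
  there, so a memory is described by a list.  A weakest precondition \<open>wp G c t Q\<close> bounds the
  number of steps by \<open>t\<close> and confines all numbers of all states to the set \<open>G\<close>;
  \<open>wp_kernel_program\<close> proves the program correct for every \<open>G\<close> that contains the values of
  the recursion, and \<open>kernel_run_bounded\<close> supplies a \<open>G\<close> all of whose elements are short.
\<close>

section \<open>The Faddeev-LeVerrier recursion\<close>

definition mat_trace :: "'a :: comm_monoid_add mat \<Rightarrow> 'a" where
  "mat_trace A = (\<Sum>i<dim_row A. A $$ (i, i))"

text \<open>
  The usual form of the recursion is \<open>M\<^bsub>k+1\<^esub> = A M\<^sub>k + c\<^sub>k I\<close> with \<open>M\<^sub>0 = I\<close>.  The matrices
  \<open>N\<^sub>k = A M\<^sub>k\<close> used here satisfy a recursion of their own, so that a program has to store only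
  one matrix per step.
\<close>

fun leverrier_mat :: "'a :: field_char_0 mat \<Rightarrow> nat \<Rightarrow> 'a mat" where
  "leverrier_mat A 0 = A"
| "leverrier_mat A (Suc k) =
     A * leverrier_mat A k + (- mat_trace (leverrier_mat A k) / of_nat (Suc k)) \<cdot>\<^sub>m A"

definition leverrier_coeff :: "'a :: field_char_0 mat \<Rightarrow> nat \<Rightarrow> 'a" where
  "leverrier_coeff A k = - mat_trace (leverrier_mat A k) / of_nat (Suc k)"

lemma leverrier_mat_Suc:
  "leverrier_mat A (Suc k) = A * leverrier_mat A k + leverrier_coeff A k \<cdot>\<^sub>m A"
  by (simp add: leverrier_coeff_def)

declare leverrier_mat.simps(2) [simp del]

lemma leverrier_mat_carrier [simp]:
  "A \<in> carrier_mat n n \<Longrightarrow> leverrier_mat A k \<in> carrier_mat n n"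
  by (induction k) (auto simp: leverrier_mat_Suc)

lemma index_leverrier_mat_Suc:
  assumes A: "A \<in> carrier_mat n n" and "i < n" "j < n"
  shows "leverrier_mat A (Suc k) $$ (i, j) =
    (\<Sum>l<n. A $$ (i, l) * leverrier_mat A k $$ (l, j)) + leverrier_coeff A k * A $$ (i, j)"
proof -
  have "leverrier_mat A k \<in> carrier_mat n n" using A by simp
  note this[THEN carrier_matD(1)] this[THEN carrier_matD(2)]
  then show ?thesis using assms
    by (auto simp: leverrier_mat_Suc scalar_prod_def atLeast0LessThan)
qed

lemma leverrier_coeff_eq:
  assumes A: "A \<in> carrier_mat n n"
  shows "leverrier_coeff A k = - (\<Sum>i<n. leverrier_mat A k $$ (i, i)) / of_nat (Suc k)"
  using leverrier_mat_carrier[OF A, of k] by (simp add: leverrier_coeff_def mat_trace_def)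

lemma leverrier_of_rat:
  assumes A: "A \<in> carrier_mat n n"
  shows "leverrier_mat (map_mat of_rat A) k =
           (map_mat of_rat (leverrier_mat A k) :: 'a :: field_char_0 mat)"
    and "leverrier_coeff (map_mat of_rat A) k = (of_rat (leverrier_coeff A k) :: 'a)"
proof (induction k)
  case 0
  have "A \<in> carrier_mat n n" "map_mat of_rat A \<in> carrier_mat n n" using A by auto
  note this[THEN leverrier_coeff_eq, of 0]
  then show "leverrier_mat (map_mat of_rat A) 0 =
           (map_mat of_rat (leverrier_mat A 0) :: 'a mat)"
    "leverrier_coeff (map_mat of_rat A) 0 = (of_rat (leverrier_coeff A 0) :: 'a)"
    using A by (auto simp: of_rat_minus of_rat_sum)
next
  case (Suc k)
  have cA: "map_mat of_rat A \<in> carrier_mat n n" using A by auto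
  have 1: "leverrier_mat (map_mat of_rat A) (Suc k) =
           (map_mat of_rat (leverrier_mat A (Suc k)) :: 'a mat)"
    using A leverrier_mat_carrier[OF A, of k] leverrier_mat_carrier[OF A, of "Suc k"]
      leverrier_mat_carrier[OF cA, of "Suc k", where ?'a = 'a]
    by (intro eq_matI)
      (auto simp: index_leverrier_mat_Suc[OF A] index_leverrier_mat_Suc[OF cA] Suc.IH
        of_rat_sum of_rat_mult of_rat_add simp del: leverrier_mat_carrier)
  then show "leverrier_mat (map_mat of_rat A) (Suc k) =
           (map_mat of_rat (leverrier_mat A (Suc k)) :: 'a mat)" .
  show "leverrier_coeff (map_mat of_rat A) (Suc k) = (of_rat (leverrier_coeff A (Suc k)) :: 'a)"
    using leverrier_mat_carrier[OF A, of "Suc k"]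
    by (simp add: leverrier_coeff_eq[OF A] leverrier_coeff_eq[OF cA] 1
        of_rat_minus of_rat_sum of_rat_divide of_rat_add)
qed

lemma mat_trace_mult_commute:
  assumes "A \<in> carrier_mat n n" "B \<in> carrier_mat n n"
  shows "mat_trace (A * B) = mat_trace (B * A :: 'a :: comm_semiring_0 mat)"
proof -
  have "mat_trace (A * B) = (\<Sum>i<n. \<Sum>j<n. A $$ (i, j) * B $$ (j, i))"
    using assms by (auto simp: mat_trace_def scalar_prod_def atLeast0LessThan)
  also have "\<dots> = (\<Sum>j<n. \<Sum>i<n. A $$ (i, j) * B $$ (j, i))"
    by (rule sum.swap)
  also have "\<dots> = mat_trace (B * A)"
    using assms by (auto simp: mat_trace_def scalar_prod_def atLeast0LessThan mult.commute)
  finally show ?thesis .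
qed

text \<open>
  The matrices of the recursion are polynomials in \<open>A\<close> and its coefficients are traces, so the
  former are conjugated and the latter are preserved by a change of basis.
\<close>

lemma leverrier_similar:
  fixes A B :: "'a :: field_char_0 mat"
  assumes wit: "similar_mat_wit A B P Q" and A: "A \<in> carrier_mat n n"
  shows "leverrier_mat A k = P * leverrier_mat B k * Q"
    and "leverrier_coeff A k = leverrier_coeff B k"
proof -
  from similar_mat_witD2[OF A wit] have PQ: "P * Q = 1\<^sub>m n" "Q * P = 1\<^sub>m n" "A = P * B * Q"
    and c[simp]: "B \<in> carrier_mat n n" "P \<in> carrier_mat n n" "Q \<in> carrier_mat n n" by auto
  have coeff: "leverrier_coeff A k = leverrier_coeff B k"
    if "leverrier_mat A k = P * leverrier_mat B k * Q" for k
  proof -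
    have [simp]: "leverrier_mat B k \<in> carrier_mat n n" by simp
    have "mat_trace (P * leverrier_mat B k * Q) = mat_trace (Q * (P * leverrier_mat B k))"
      by (rule mat_trace_mult_commute[of _ n]) (simp_all add: mult_carrier_mat[of _ n n])
    also have "Q * (P * leverrier_mat B k) = leverrier_mat B k"
      by (simp add: PQ(2) left_mult_one_mat[of _ n n] flip: assoc_mult_mat[of _ n n _ n _ n])
    finally show ?thesis by (simp add: leverrier_coeff_def that)
  qed
  show *: "leverrier_mat A k = P * leverrier_mat B k * Q" for k
  proof (induction k)
    case (Suc k)
    define N where "N = leverrier_mat B k"
    have [simp]: "N \<in> carrier_mat n n" by (simp add: N_def)
    define c where "c = leverrier_coeff B k"
    have "A * (P * N * Q) = P * (B * N) * Q"
    proof -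
      have "A * (P * N * Q) = P * B * (Q * P) * N * Q"
        unfolding PQ(3) by (simp add: assoc_mult_mat[of _ n n _ n _ n] mult_carrier_mat[of _ n n _ n])
      also have "\<dots> = P * (B * N) * Q"
        unfolding PQ(2)
        by (simp add: assoc_mult_mat[of _ n n _ n _ n] mult_carrier_mat[of _ n n _ n]
            left_mult_one_mat[of _ n n])
      finally show ?thesis .
    qed
    note eq = this
    have IH: "leverrier_mat A k = P * N * Q" using Suc.IH by (simp add: N_def)
    have "leverrier_mat A (Suc k) = A * (P * N * Q) + c \<cdot>\<^sub>m A"
      unfolding leverrier_mat_Suc IH coeff[OF Suc.IH] c_def ..
    also have "\<dots> = P * (B * N) * Q + c \<cdot>\<^sub>m (P * B * Q)" unfolding eq by (simp only: PQ(3))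
    also have "\<dots> = P * (B * N + c \<cdot>\<^sub>m B) * Q"
      by (simp add: mult_add_distrib_mat[of _ n n _ n] add_mult_distrib_mat[of _ n n _ _ n]
          mult_smult_distrib[of _ n n _ n] mult_smult_assoc_mat[of _ n n _ n]
          mult_carrier_mat[of _ n n _ n])
    finally show ?case by (simp only: leverrier_mat_Suc N_def c_def)
  qed (simp add: PQ)
  show "leverrier_coeff A k = leverrier_coeff B k" by (rule coeff[OF *])
qed

text \<open>
  Let \<open>\<lambda>\<^sub>i\<close> be the diagonal entries, \<open>q = \<Prod>\<^sub>i (1 - \<lambda>\<^sub>i x)\<close> and \<open>r\<^sub>i = q / (1 - \<lambda>\<^sub>i x)\<close>.  The
  claim is that \<open>c\<^sub>k\<close> is the coefficient of \<open>x^(k+1)\<close> in \<open>q\<close>.  Diagonals of triangular matrices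
  multiply entrywise, and comparing coefficients in \<open>q = (1 - \<lambda>\<^sub>i x) r\<^sub>i\<close> shows that
  \<open>\<lambda>\<^sub>i [x^k] r\<^sub>i\<close> obeys the recursion of the \<open>i\<close>-th diagonal entry of \<open>N\<^sub>k\<close>, as long as the
  claim holds below \<open>k\<close>.  Then \<open>q' = - \<Sum>\<^sub>i \<lambda>\<^sub>i r\<^sub>i\<close> identifies the trace of \<open>N\<^sub>k\<close> with
  \<open>- (k + 1) [x^(k+1)] q\<close>, which is the claim for \<open>k\<close>.
\<close>

lemma leverrier_upper_triangular:
  fixes B :: "'a :: field_char_0 mat"
  assumes B: "B \<in> carrier_mat n n" and ut: "upper_triangular B"
  shows "leverrier_coeff B k = coeff (\<Prod>i<n. [:1, - B $$ (i, i):]) (Suc k)"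
proof -
  define q where "q = (\<Prod>i<n. [:1, - B $$ (i, i):])"
  define r where "r i = (\<Prod>j\<in>{..<n} - {i}. [:1, - B $$ (j, j):])" for i
  have q_r: "q = [:1, - B $$ (i, i):] * r i" if "i < n" for i
    unfolding q_def r_def using that by (intro prod.remove) auto
  have zero: "B $$ (i, j) = 0" if "j < i" "i < n" for i j
    using ut that B by auto
  have ut_lev: "leverrier_mat B k $$ (i, j) = 0" if "j < i" "i < n" for i j k
    using that
  proof (induction k arbitrary: i j)
    case (Suc k)
    have "B $$ (i, l) * leverrier_mat B k $$ (l, j) = 0" if "l < n" for l
      using Suc zero[of l i] that by (cases "l < i") auto
    then have "(\<Sum>l<n. B $$ (i, l) * leverrier_mat B k $$ (l, j)) = 0"
      by (intro sum.neutral) blast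
    then show ?case using Suc.prems zero[of j i]
      by (simp add: index_leverrier_mat_Suc[OF B])
  qed (use zero in auto)
  \<comment> \<open>Newton's identity, conditional on the description of the diagonal that is proved after it\<close>
  have newton: "leverrier_coeff B k = coeff q (Suc k)"
    if diag: "\<And>i. i < n \<Longrightarrow> leverrier_mat B k $$ (i, i) = B $$ (i, i) * coeff (r i) k" for k
  proof -
    have "of_nat (Suc k) * coeff q (Suc k) = coeff (pderiv q) k"
      by (simp add: coeff_pderiv)
    also have "pderiv q = (\<Sum>i<n. r i * [:- B $$ (i, i):])"
      unfolding q_def r_def by (subst pderiv_prod) (simp add: pderiv_pCons)
    also have "coeff \<dots> k = - (\<Sum>i<n. leverrier_mat B k $$ (i, i))"
      by (simp add: coeff_sum diag sum_negf mult.commute)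
    finally have "of_nat (Suc k) * coeff q (Suc k) = - (\<Sum>i<n. leverrier_mat B k $$ (i, i))" .
    then show ?thesis unfolding leverrier_coeff_eq[OF B]
      by (metis nonzero_mult_div_cancel_left of_nat_eq_0_iff nat.distinct(1))
  qed
  have "leverrier_mat B k $$ (i, i) = B $$ (i, i) * coeff (r i) k" if "i < n" for i
    using that
  proof (induction k arbitrary: i)
    case 0
    have "coeff (r i) 0 = 1"
      unfolding r_def poly_0_coeff_0[symmetric] poly_prod by simp
    then show ?case by simp
  next
    case (Suc k)
    have "(\<Sum>l<n. B $$ (i, l) * leverrier_mat B k $$ (l, i)) =
      (\<Sum>l<n. if l = i then B $$ (i, i) * leverrier_mat B k $$ (i, i) else 0)"
    proof (rule sum.cong)
      fix l assume "l \<in> {..<n}"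
      then show "B $$ (i, l) * leverrier_mat B k $$ (l, i) =
          (if l = i then B $$ (i, i) * leverrier_mat B k $$ (i, i) else 0)"
        using zero[of l i] ut_lev[of i l k] Suc.prems by (cases l i rule: linorder_cases) auto
    qed simp
    also have "\<dots> = B $$ (i, i) * leverrier_mat B k $$ (i, i)" using Suc.prems by simp
    finally have "leverrier_mat B (Suc k) $$ (i, i) =
        B $$ (i, i) * (leverrier_mat B k $$ (i, i) + leverrier_coeff B k)"
      using Suc.prems by (simp add: index_leverrier_mat_Suc[OF B] algebra_simps)
    also have "leverrier_coeff B k = coeff q (Suc k)" by (rule newton) (rule Suc.IH)
    also have "\<dots> = coeff (r i) (Suc k) - B $$ (i, i) * coeff (r i) k"
      using q_r[OF Suc.prems] by simp
    finally show ?case using Suc by simp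
  qed
  then have "leverrier_coeff B k = coeff q (Suc k)" by (intro newton) auto
  then show ?thesis by (simp add: q_def)
qed

lemma coeff_prod_linear:
  "coeff (\<Prod>i<n. [:1, - f i:]) n = (\<Prod>i<n. - f i :: 'a :: comm_ring_1)"
proof (induction n)
  case (Suc n)
  have "degree (\<Prod>i<n. [:1, - f i:]) \<le> (\<Sum>i<n. 1)"
    by (rule order_trans[OF degree_prod_sum_le], simp, rule sum_mono) simp
  then have "coeff (\<Prod>i<n. [:1, - f i:]) (Suc n) = 0" by (intro coeff_eq_0) simp
  with Suc show ?case by (simp add: mult.commute)
qed simp

text \<open>
  Over the complex numbers every matrix is triangularizable, and there \<open>c\<^sub>n\<close> is the coefficient
  of \<open>x^(n+1)\<close> in \<open>\<Prod>\<^sub>i (1 - \<lambda>\<^sub>i x)\<close>, which is \<open>\<Prod>\<^sub>i (- \<lambda>\<^sub>i) = \<plusminus> det A\<close>.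
\<close>

theorem leverrier_coeff_eq_0_iff:
  assumes A: "(A :: rat mat) \<in> carrier_mat (Suc n) (Suc n)"
  shows "leverrier_coeff A n = 0 \<longleftrightarrow> det A = 0"
proof -
  interpret of_rat_complex: comm_ring_hom "of_rat :: rat \<Rightarrow> complex"
    by unfold_locales (auto simp: of_rat_add of_rat_mult)
  define C where "C = (map_mat of_rat A :: complex mat)"
  have C: "C \<in> carrier_mat (Suc n) (Suc n)" using A by (simp add: C_def)
  obtain es where "char_poly C = (\<Prod>a\<leftarrow>es. [:- a, 1:])"
    using char_poly_factorized[OF C] by blast
  from schur_decomposition_exists[OF C this] obtain B where
    B: "B \<in> carrier_mat (Suc n) (Suc n)" "upper_triangular B" "similar_mat C B" by blast
  obtain P Q where wit: "similar_mat_wit C B P Q" using B(3) by (auto simp: similar_mat_def)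
  have "of_rat (leverrier_coeff A n) = leverrier_coeff C n"
    using leverrier_of_rat(2)[OF A, of n, where ?'a = complex] by (simp add: C_def)
  also have "\<dots> = leverrier_coeff B n" by (rule leverrier_similar[OF wit C])
  also have "\<dots> = (\<Prod>i<Suc n. - B $$ (i, i))"
    using leverrier_upper_triangular[OF B(1,2)] coeff_prod_linear[of "\<lambda>i. B $$ (i, i)" "Suc n"]
    by simp
  finally have "leverrier_coeff A n = 0 \<longleftrightarrow> (\<Prod>i<Suc n. B $$ (i, i)) = 0"
    by (metis (no_types, lifting) finite_lessThan neg_equal_0_iff_equal of_rat_eq_0_iff prod_zero_iff)
  also have "(\<Prod>i<Suc n. B $$ (i, i)) = det B"
    using B by (simp add: det_upper_triangular[OF B(2,1)] prod_list_diag_prod atLeast0LessThan)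
  also have "\<dots> = det C" using det_similar[OF B(3)] by simp
  also have "\<dots> = of_rat (det A)" by (simp add: C_def)
  finally show ?thesis by simp
qed


section \<open>The common kernel and the sum of squares of the coefficients\<close>

text \<open>
  The product \<open>P\<^sub>k\<^sup>2\<close> is written instead of \<open>P\<^sub>k\<^sup>T P\<^sub>k\<close>; for the symmetric matrices considered
  here both agree.
\<close>

definition sum_of_squares :: "nat \<Rightarrow> nat \<Rightarrow> rat poly mat \<Rightarrow> rat mat" where
  "sum_of_squares n d P =
     mat n n (\<lambda>(i, j). \<Sum>k<Suc d. \<Sum>l<n. coeff (P $$ (i, l)) k * coeff (P $$ (l, j)) k)"

lemma sum_of_squares_carrier [simp]: "sum_of_squares n d P \<in> carrier_mat n n"
  by (simp add: sum_of_squares_def)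

text \<open>
  For fixed \<open>x\<close> each component of \<open>P(t) x\<close> is a polynomial in \<open>t\<close>, whose coefficients are the
  components of the vectors \<open>P\<^sub>k x\<close>; it has infinitely many zeros only if it is zero.
\<close>

lemma common_kernel_iff_coefficients:
  assumes P: "P \<in> carrier_mat n n"
  shows "x \<in> (\<Inter>t \<in> {-1..1}. mat_kernel (eval_poly_mat P t)) \<longleftrightarrow>
    x \<in> carrier_vec n \<and> (\<forall>i<n. \<forall>k. (\<Sum>j<n. of_rat (coeff (P $$ (i, j)) k) * x $ j) = 0)"
    (is "_ \<longleftrightarrow> _ \<and> ?zero")
proof (cases "x \<in> carrier_vec n")
  case True
  define R where "R i = (\<Sum>j<n. smult (x $ j) (map_poly of_rat (P $$ (i, j))))" for i
  have coeff_R: "coeff (R i) k = (\<Sum>j<n. of_rat (coeff (P $$ (i, j)) k) * x $ j)" for i k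
    by (simp add: R_def coeff_sum coeff_map_poly mult.commute)
  have "(eval_poly_mat P t *\<^sub>v x) $ i = poly (R i) t" if "i < n" for i t
    using that True P
    by (simp add: eval_poly_mat_def R_def poly_sum scalar_prod_def atLeast0LessThan mult.commute)
  then have "x \<in> mat_kernel (eval_poly_mat P t) \<longleftrightarrow> (\<forall>i<n. poly (R i) t = 0)" for t
    using True P by (auto simp: mat_kernel_def eval_poly_mat_def vec_eq_iff)
  moreover have "(\<forall>t \<in> {-1..1}. poly (R i) t = 0) \<longleftrightarrow> R i = 0" for i
  proof
    assume *: "\<forall>t \<in> {-1..1}. poly (R i) t = 0"
    show "R i = 0"
    proof (rule ccontr)
      assume "R i \<noteq> 0"
      then have "finite {t. poly (R i) t = 0}" by (rule poly_roots_finite)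
      moreover have "{-1..1} \<subseteq> {t. poly (R i) t = 0}" using * by auto
      ultimately have "finite {-1..1::real}" by (rule rev_finite_subset)
      then show False using infinite_Icc[of "-1" "1::real"] by simp
    qed
  qed simp
  ultimately have "x \<in> (\<Inter>t \<in> {-1..1}. mat_kernel (eval_poly_mat P t)) \<longleftrightarrow> (\<forall>i<n. R i = 0)"
    by (simp only: INT_iff) blast
  then show ?thesis using True by (simp add: poly_eq_iff coeff_R)
next
  case False
  then show ?thesis using P by (auto simp: mat_kernel_def eval_poly_mat_def intro!: bexI[of _ 0])
qed

text \<open>
  If \<open>A x = 0\<close>, then \<open>0 = x\<^sup>T A x = \<Sum>\<^sub>k |P\<^sub>k x|\<^sup>2\<close>, so all \<open>P\<^sub>k x\<close> vanish.  The determinant may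
  be taken over the rationals, because it commutes with the embedding into the reals.
\<close>

theorem common_kernel_trivial_iff:
  assumes "(n, d, P) \<in> sym_poly_matrices"
  shows "(\<Inter>t \<in> {-1..1}. mat_kernel (eval_poly_mat P t)) = {0\<^sub>v n} \<longleftrightarrow>
    det (sum_of_squares n d P) \<noteq> 0"
proof -
  have P: "P \<in> carrier_mat n n" and sym: "transpose_mat P = P"
    and deg: "\<And>i j. i < n \<Longrightarrow> j < n \<Longrightarrow> degree (P $$ (i, j)) \<le> d"
    using assms by (auto simp: sym_poly_matrices_def)
  have symm: "P $$ (i, j) = P $$ (j, i)" if "i < n" "j < n" for i j
    using arg_cong[OF sym, of "\<lambda>M. M $$ (i, j)"] that P by simp
  interpret of_rat_real: inj_comm_ring_hom "of_rat :: rat \<Rightarrow> real"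
    by unfold_locales (auto simp: of_rat_add of_rat_mult)
  define A where "A = (map_mat of_rat (sum_of_squares n d P) :: real mat)"
  define lin where "lin x i k = (\<Sum>j<n. of_rat (coeff (P $$ (i, j)) k) * x $ j)"
    for x :: "real vec" and i k
  have A: "A \<in> carrier_mat n n" by (simp add: A_def)
  have Ax: "(A *\<^sub>v x) $ i = (\<Sum>k<Suc d. \<Sum>l<n. of_rat (coeff (P $$ (i, l)) k) * lin x l k)"
    if "i < n" "x \<in> carrier_vec n" for x i
  proof -
    have "(A *\<^sub>v x) $ i = (\<Sum>j<n. (\<Sum>k<Suc d. \<Sum>l<n.
        of_rat (coeff (P $$ (i, l)) k) * of_rat (coeff (P $$ (l, j)) k)) * x $ j)"
      using that
      by (simp add: A_def sum_of_squares_def scalar_prod_def atLeast0LessThan of_rat_sum of_rat_mult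
          of_rat_add del: sum.lessThan_Suc)
    also have "\<dots> = (\<Sum>j<n. \<Sum>k<Suc d. \<Sum>l<n.
        of_rat (coeff (P $$ (i, l)) k) * (of_rat (coeff (P $$ (l, j)) k) * x $ j))"
      by (simp only: sum_distrib_right mult.assoc)
    also have "\<dots> = (\<Sum>k<Suc d. \<Sum>j<n. \<Sum>l<n.
        of_rat (coeff (P $$ (i, l)) k) * (of_rat (coeff (P $$ (l, j)) k) * x $ j))"
      by (rule sum.swap)
    also have "\<dots> = (\<Sum>k<Suc d. \<Sum>l<n. \<Sum>j<n.
        of_rat (coeff (P $$ (i, l)) k) * (of_rat (coeff (P $$ (l, j)) k) * x $ j))"
      by (rule sum.cong[OF refl]) (rule sum.swap)
    also have "\<dots> = (\<Sum>k<Suc d. \<Sum>l<n. of_rat (coeff (P $$ (i, l)) k) * lin x l k)"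
      by (simp only: lin_def sum_distrib_left)
    finally show ?thesis .
  qed
  have "A *\<^sub>v x = 0\<^sub>v n \<longleftrightarrow> (\<forall>i<n. \<forall>k. lin x i k = 0)" if x: "x \<in> carrier_vec n" for x
  proof
    assume zero: "A *\<^sub>v x = 0\<^sub>v n"
    have "(\<Sum>k<Suc d. \<Sum>l<n. (lin x l k)\<^sup>2) =
        (\<Sum>k<Suc d. \<Sum>l<n. \<Sum>i<n. x $ i * (of_rat (coeff (P $$ (i, l)) k) * lin x l k))"
    proof (intro sum.cong refl)
      fix k l assume "l \<in> {..<n}"
      then have "lin x l k = (\<Sum>i<n. of_rat (coeff (P $$ (i, l)) k) * x $ i)"
        unfolding lin_def using symm by (intro sum.cong) auto
      then show "(lin x l k)\<^sup>2 =
          (\<Sum>i<n. x $ i * (of_rat (coeff (P $$ (i, l)) k) * lin x l k))"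
        by (simp add: power2_eq_square sum_distrib_right mult_ac)
    qed
    also have "\<dots> = (\<Sum>k<Suc d. \<Sum>i<n. \<Sum>l<n. x $ i * (of_rat (coeff (P $$ (i, l)) k) * lin x l k))"
      by (rule sum.cong[OF refl]) (rule sum.swap)
    also have "\<dots> = (\<Sum>i<n. \<Sum>k<Suc d. \<Sum>l<n. x $ i * (of_rat (coeff (P $$ (i, l)) k) * lin x l k))"
      by (rule sum.swap)
    also have "\<dots> = (\<Sum>i<n. x $ i * (A *\<^sub>v x) $ i)"
      using x by (intro sum.cong refl) (simp add: Ax sum_distrib_left del: sum.lessThan_Suc)
    also have "\<dots> = 0" by (simp add: zero)
    finally have *: "(\<Sum>k<Suc d. \<Sum>l<n. (lin x l k)\<^sup>2) = 0" .
    have "lin x i k = 0" if "i < n" for i k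
    proof (cases "k \<le> d")
      case True
      have "(\<Sum>l<n. (lin x l k)\<^sup>2) = 0"
        using * True by (subst (asm) sum_nonneg_eq_0_iff) (auto intro: sum_nonneg)
      then show ?thesis using that by (subst (asm) sum_nonneg_eq_0_iff) auto
    next
      case False
      then have "coeff (P $$ (i, j)) k = 0" if "j < n" for j
        using deg[of i j] \<open>i < n\<close> that by (intro coeff_eq_0) auto
      then show ?thesis by (simp add: lin_def)
    qed
    then show "\<forall>i<n. \<forall>k. lin x i k = 0" by blast
  next
    assume "\<forall>i<n. \<forall>k. lin x i k = 0"
    then show "A *\<^sub>v x = 0\<^sub>v n"
      using A x by (auto simp: Ax vec_eq_iff simp del: index_mult_mat_vec sum.lessThan_Suc)
  qed
  then have "(\<Inter>t \<in> {-1..1}. mat_kernel (eval_poly_mat P t)) =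
      {x \<in> carrier_vec n. A *\<^sub>v x = 0\<^sub>v n}"
    using common_kernel_iff_coefficients[OF P] unfolding lin_def by blast
  moreover have "A *\<^sub>v 0\<^sub>v n = 0\<^sub>v n" using A by (intro eq_vecI) auto
  ultimately have "(\<Inter>t \<in> {-1..1}. mat_kernel (eval_poly_mat P t)) = {0\<^sub>v n} \<longleftrightarrow> det A \<noteq> 0"
    unfolding det_0_iff_vec_prod_zero[OF A] by auto
  also have "det A = of_rat (det (sum_of_squares n d P))"
    by (simp add: A_def)
  finally show ?thesis by simp
qed


section \<open>Reasoning about programs\<close>

text \<open>
  Running time and encoding lengths concern all states of a run.  Both are part of the
  judgement: at most \<open>t\<close> operations are performed, and no register or memory cell ever leaves
  \<open>G\<close>.
\<close>

definition wp :: "rat set \<Rightarrow> com \<Rightarrow> nat \<Rightarrow> (state \<Rightarrow> bool) \<Rightarrow> state \<Rightarrow> bool" where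
  "wp G c t Q s \<longleftrightarrow> (\<exists>ss s'. run c s ss s' \<and> length ss \<le> t \<and> Q s' \<and>
     (\<forall>u \<in> set ss \<union> {s'}. numbers_in u \<subseteq> G))"

lemma wp_mono:
  "wp G c t Q s \<Longrightarrow> t \<le> t' \<Longrightarrow> (\<And>s'. Q s' \<Longrightarrow> numbers_in s' \<subseteq> G \<Longrightarrow> Q' s') \<Longrightarrow> wp G c t' Q' s"
  unfolding wp_def by (meson UnCI insertI1 order_trans)

lemma wp_Skip: "Q s \<Longrightarrow> numbers_in s \<subseteq> G \<Longrightarrow> wp G Skip 0 Q s"
  unfolding wp_def by (intro exI[of _ "[]"] exI[of _ s] conjI run_Skip) auto

lemma wp_Instr:
  "exec_instr a s = Some s' \<Longrightarrow> Q s' \<Longrightarrow> numbers_in s \<subseteq> G \<Longrightarrow> numbers_in s' \<subseteq> G \<Longrightarrow>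
   wp G (Instr a) (Suc 0) Q s"
  unfolding wp_def by (intro exI[of _ "[s]"] exI[of _ s'] conjI run_Instr) auto

lemma wp_Seq:
  assumes "wp G c1 t1 (wp G c2 t2 Q) s"
  shows "wp G (Seq c1 c2) (t1 + t2) Q s"
proof -
  obtain ss1 s1 where 1: "run c1 s ss1 s1" "length ss1 \<le> t1" "wp G c2 t2 Q s1"
    "\<forall>u \<in> set ss1 \<union> {s1}. numbers_in u \<subseteq> G"
    using assms unfolding wp_def by blast
  obtain ss2 s2 where 2: "run c2 s1 ss2 s2" "length ss2 \<le> t2" "Q s2"
    "\<forall>u \<in> set ss2 \<union> {s2}. numbers_in u \<subseteq> G"
    using 1(3) unfolding wp_def by blast
  show ?thesis unfolding wp_def
    using 1 2 by (intro exI[of _ "ss1 @ ss2"] exI[of _ s2]) (auto intro: run_Seq)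
qed

lemma wp_If:
  assumes "numbers_in s \<subseteq> G"
    and "holds b s \<Longrightarrow> wp G c1 t Q s" and "\<not> holds b s \<Longrightarrow> wp G c2 t Q s"
  shows "wp G (If b c1 c2) (Suc t) Q s"
proof (cases "holds b s")
  case True
  then obtain ss s' where "run c1 s ss s'" "length ss \<le> t" "Q s'"
    "\<forall>u \<in> set ss \<union> {s'}. numbers_in u \<subseteq> G"
    using assms(2) unfolding wp_def by blast
  then show ?thesis unfolding wp_def
    using True assms(1) by (intro exI[of _ "s # ss"] exI[of _ s']) (auto intro: run_IfTrue)
next
  case False
  then obtain ss s' where "run c2 s ss s'" "length ss \<le> t" "Q s'"
    "\<forall>u \<in> set ss \<union> {s'}. numbers_in u \<subseteq> G"
    using assms(3) unfolding wp_def by blast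
  then show ?thesis unfolding wp_def
    using False assms(1) by (intro exI[of _ "s # ss"] exI[of _ s']) (auto intro: run_IfFalse)
qed

lemma wp_While_False:
  "\<not> holds b s \<Longrightarrow> Q s \<Longrightarrow> numbers_in s \<subseteq> G \<Longrightarrow> wp G (While b c) 1 Q s"
  unfolding wp_def by (intro exI[of _ "[s]"] exI[of _ s] conjI run_WhileFalse) auto

lemma wp_While_True:
  assumes "holds b s" "numbers_in s \<subseteq> G" "wp G c t1 (wp G (While b c) t2 Q) s"
  shows "wp G (While b c) (Suc (t1 + t2)) Q s"
proof -
  obtain ss1 s1 where 1: "run c s ss1 s1" "length ss1 \<le> t1" "wp G (While b c) t2 Q s1"
    "\<forall>u \<in> set ss1 \<union> {s1}. numbers_in u \<subseteq> G"
    using assms unfolding wp_def by blast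
  obtain ss2 s2 where 2: "run (While b c) s1 ss2 s2" "length ss2 \<le> t2" "Q s2"
    "\<forall>u \<in> set ss2 \<union> {s2}. numbers_in u \<subseteq> G"
    using 1(3) unfolding wp_def by blast
  show ?thesis unfolding wp_def
    using 1 2 assms by (intro exI[of _ "s # ss1 @ ss2"] exI[of _ s2]) (auto intro: run_WhileTrue)
qed

text \<open>
  A loop whose iterations are numbered by the invariant.  The bound counts, besides the \<open>t\<close>
  steps of the body, one comparison per iteration and the final one.
\<close>

lemma wp_While_count:
  assumes step: "\<And>k s. k < N \<Longrightarrow> I k s \<Longrightarrow> numbers_in s \<subseteq> G \<Longrightarrow> holds b s \<and> wp G c t (I (Suc k)) s"
    and stop: "\<And>s. I N s \<Longrightarrow> \<not> holds b s"
  shows "k \<le> N \<Longrightarrow> I k s \<Longrightarrow> numbers_in s \<subseteq> G \<Longrightarrow> wp G (While b c) ((N - k) * Suc t + 1) (I N) s"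
proof (induction "N - k" arbitrary: k s)
  case 0
  then have "k = N" by simp
  with 0 stop[of s] wp_While_False[of b s "I N" G c] show ?case by simp
next
  case (Suc m)
  then have "k < N" by simp
  have "wp G c t (wp G (While b c) ((N - Suc k) * Suc t + 1) (I N)) s"
  proof (rule wp_mono)
    show "wp G c t (I (Suc k)) s" using step \<open>k < N\<close> Suc.prems by blast
    fix s' assume "I (Suc k) s'" "numbers_in s' \<subseteq> G"
    then show "wp G (While b c) ((N - Suc k) * Suc t + 1) (I N) s'"
      using Suc.hyps(1)[of "Suc k" s'] Suc.hyps(2) \<open>k < N\<close> by simp
  qed simp
  then have "wp G (While b c) (Suc (t + ((N - Suc k) * Suc t + 1))) (I N) s"
    using step[OF \<open>k < N\<close> Suc.prems(2,3)] Suc.prems by (intro wp_While_True) auto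
  moreover have "N - k = Suc (N - Suc k)" using \<open>k < N\<close> by simp
  then have "Suc (t + ((N - Suc k) * Suc t + 1)) = (N - k) * Suc t + 1" by (simp only:) simp
  ultimately show ?case by (simp only:)
qed

fun block :: "instr list \<Rightarrow> com" where
  "block [] = Skip"
| "block (a # as) = Seq (Instr a) (block as)"

text \<open>
  The weakest precondition of straight-line code as a recursive function, so that the simplifier
  can execute a block symbolically.  Only the value that an instruction writes has to be checked
  against \<open>G\<close>.
\<close>

fun steps :: "rat set \<Rightarrow> instr list \<Rightarrow> (state \<Rightarrow> bool) \<Rightarrow> (nat \<Rightarrow> rat) \<Rightarrow> (nat \<Rightarrow> rat) \<Rightarrow> bool" where
  "steps G [] Q r m = Q (r, m)"
| "steps G (Const i q # as) Q r m = (q \<in> G \<and> steps G as Q (r(i := q)) m)"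
| "steps G (Move i j # as) Q r m = (r j \<in> G \<and> steps G as Q (r(i := r j)) m)"
| "steps G (Add i j k # as) Q r m = (r j + r k \<in> G \<and> steps G as Q (r(i := r j + r k)) m)"
| "steps G (Sub i j k # as) Q r m = (r j - r k \<in> G \<and> steps G as Q (r(i := r j - r k)) m)"
| "steps G (Mul i j k # as) Q r m = (r j * r k \<in> G \<and> steps G as Q (r(i := r j * r k)) m)"
| "steps G (Div i j k # as) Q r m =
     (r k \<noteq> 0 \<and> r j / r k \<in> G \<and> steps G as Q (r(i := r j / r k)) m)"
| "steps G (Load i a # as) Q r m =
     (r a \<in> \<nat> \<and> m (nat \<lfloor>r a\<rfloor>) \<in> G \<and> steps G as Q (r(i := m (nat \<lfloor>r a\<rfloor>))) m)"
| "steps G (Store a j # as) Q r m =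
     (r a \<in> \<nat> \<and> r j \<in> G \<and> steps G as Q r (m(nat \<lfloor>r a\<rfloor> := r j)))"

lemma numbers_in_upd:
  "numbers_in (r, m) \<subseteq> G \<Longrightarrow> y \<in> G \<Longrightarrow> numbers_in (r(i := y), m) \<subseteq> G"
  "numbers_in (r, m) \<subseteq> G \<Longrightarrow> y \<in> G \<Longrightarrow> numbers_in (r, m(a := y)) \<subseteq> G"
  by (auto simp: numbers_in_def image_subset_iff)

lemma wp_block:
  "numbers_in (r, m) \<subseteq> G \<Longrightarrow> steps G as Q r m \<Longrightarrow> wp G (block as) (length as) Q (r, m)"
proof (induction as arbitrary: r m)
  case Nil
  then show ?case by (auto intro: wp_Skip)
next
  case (Cons a as)
  have "\<exists>s'. exec_instr a (r, m) = Some s' \<and> numbers_in s' \<subseteq> G \<and> steps G as Q (fst s') (snd s')"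
    using Cons.prems by (cases a) (simp_all add: numbers_in_upd)
  then obtain r' m' where "exec_instr a (r, m) = Some (r', m')" "numbers_in (r', m') \<subseteq> G"
    "steps G as Q r' m'" by force
  then have "wp G (Seq (Instr a) (block as)) (Suc 0 + length as) Q (r, m)"
    using Cons by (intro wp_Seq wp_Instr) auto
  then show ?case by simp
qed

text \<open>
  The registers of the program.  The input format fixes the first two: \<open>rN\<close> holds \<open>n\<close> and, at
  the end, the answer; \<open>rD\<close> is raised from \<open>d\<close> to \<open>d + 1\<close>, the number of coefficients.  The
  addresses in \<open>rFree\<close>, \<open>rBase\<close> and \<open>rCur\<close> are the first cell that has not been written, the
  first cell of \<open>A\<close> and the first cell of \<open>N\<^sub>k\<close>.
\<close>

abbreviation (input) rN :: nat where "rN \<equiv> 0"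
abbreviation (input) rD :: nat where "rD \<equiv> 1"
abbreviation (input) rOne :: nat where "rOne \<equiv> 2"
abbreviation (input) rI :: nat where "rI \<equiv> 3"
abbreviation (input) rJ :: nat where "rJ \<equiv> 4"
abbreviation (input) rK :: nat where "rK \<equiv> 5"
abbreviation (input) rL :: nat where "rL \<equiv> 6"
abbreviation (input) rAcc :: nat where "rAcc \<equiv> 7"
abbreviation (input) rX :: nat where "rX \<equiv> 8"
abbreviation (input) rY :: nat where "rY \<equiv> 9"
abbreviation (input) rT :: nat where "rT \<equiv> 10"
abbreviation (input) rFree :: nat where "rFree \<equiv> 11"
abbreviation (input) rBase :: nat where "rBase \<equiv> 12"
abbreviation (input) rCur :: nat where "rCur \<equiv> 13"
abbreviation (input) rC :: nat where "rC \<equiv> 14"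
abbreviation (input) rZero :: nat where "rZero \<equiv> 15"
abbreviation (input) rTwo :: nat where "rTwo \<equiv> 16"

text \<open>The frame condition of a program that uses \<open>X\<close> as scratch registers.\<close>

definition agree_off :: "nat set \<Rightarrow> (nat \<Rightarrow> rat) \<Rightarrow> (nat \<Rightarrow> rat) \<Rightarrow> bool" where
  "agree_off X r r' \<longleftrightarrow> (\<forall>a. a \<notin> X \<longrightarrow> r' a = r a)"

lemma agree_offD: "agree_off X r r' \<Longrightarrow> a \<notin> X \<Longrightarrow> r' a = r a"
  by (simp add: agree_off_def)

lemma agree_off_trans:
  "agree_off X r r' \<Longrightarrow> agree_off Y r' r'' \<Longrightarrow> X \<union> Y \<subseteq> Z \<Longrightarrow> agree_off Z r r''"
  unfolding agree_off_def by (metis UnCI subsetD)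

lemma agree_off_upd: "agree_off X r r' \<Longrightarrow> a \<in> X \<Longrightarrow> agree_off X r (r'(a := y))"
  by (auto simp: agree_off_def)

text \<open>
  All memories that occur have this form: cells behind the list are still zero, and storing at
  the first of them appends to the list.
\<close>

definition mem_of :: "rat list \<Rightarrow> nat \<Rightarrow> rat" where
  "mem_of xs = (\<lambda>a. if a < length xs then xs ! a else 0)"

lemma mem_of_snoc: "(mem_of xs)(length xs := y) = mem_of (xs @ [y])"
  by (auto simp: mem_of_def nth_append)

lemma mem_of_append: "a < length xs \<Longrightarrow> mem_of (xs @ ys) a = xs ! a"
  by (simp add: mem_of_def nth_append)

definition For :: "nat \<Rightarrow> nat \<Rightarrow> com \<Rightarrow> com" where
  "For i b c = Seq (Instr (Const i 0)) (While (Less i b) (Seq c (Instr (Add i i rOne))))"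

lemma wp_SeqI:
  "wp G c1 t1 R s \<Longrightarrow> (\<And>s'. R s' \<Longrightarrow> numbers_in s' \<subseteq> G \<Longrightarrow> wp G c2 t2 Q s') \<Longrightarrow>
   wp G (Seq c1 c2) (t1 + t2) Q s"
  by (rule wp_Seq, erule wp_mono) simp_all

text \<open>
  The counter belongs to the loop, so the body establishes the invariant for the state in which
  the counter has already been advanced.  Each iteration adds a comparison and the increment to
  the \<open>T\<close> steps of the body; the initialization and the last comparison give the other two.
\<close>

lemma wp_For:
  assumes start: "I 0 (r(i := 0), m)" "numbers_in (r, m) \<subseteq> G"
    and nats: "\<And>k. k \<le> N \<Longrightarrow> of_nat k \<in> G"
    and counter: "\<And>k r m. k \<le> N \<Longrightarrow> I k (r, m) \<Longrightarrow> r i = of_nat k \<and> r b = of_nat N"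
    and body: "\<And>k r m. k < N \<Longrightarrow> I k (r, m) \<Longrightarrow> numbers_in (r, m) \<subseteq> G \<Longrightarrow>
      wp G c T (\<lambda>(r', m'). r' i = of_nat k \<and> r' rOne = 1 \<and> I (Suc k) (r'(i := of_nat (Suc k)), m'))
        (r, m)"
  shows "wp G (For i b c) (N * (T + 2) + 2) (I N) (r, m)"
proof -
  have nats': "1 + of_nat k \<in> G" if "k < N" for k
    using nats[of "Suc k"] that by simp
  have "wp G (For i b c) (Suc 0 + ((N - 0) * Suc (T + Suc 0) + 1)) (I N) (r, m)"
    unfolding For_def
  proof (rule wp_Seq, rule wp_Instr)
    have "numbers_in (r(i := 0), m) \<subseteq> G"
      using start nats[of 0] by (simp add: numbers_in_upd)
    then show "wp G (While (Less i b)
      (Seq c (Instr (Add i i rOne)))) ((N - 0) * Suc (T + Suc 0) + 1)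
        (I N) (r(i := 0), m)"
    proof (intro wp_While_count)
      fix k s assume k: "k < N" "I k s" "numbers_in s \<subseteq> G"
      obtain r m where s: "s = (r, m)" by force
      have "wp G (Seq c (Instr (Add i i rOne))) (T + Suc 0) (I (Suc k)) (r, m)"
      proof (rule wp_SeqI)
        show "wp G c T (\<lambda>(r', m'). r' i = of_nat k \<and> r' rOne = 1 \<and>
            I (Suc k) (r'(i := of_nat (Suc k)), m')) (r, m)"
          using body k s by blast
        fix s' assume *: "case s' of (r', m') \<Rightarrow> r' i = of_nat k \<and> r' rOne = 1 \<and>
            I (Suc k) (r'(i := of_nat (Suc k)), m')" "numbers_in s' \<subseteq> G"
        obtain r' m' where s': "s' = (r', m')" by force
        show "wp G (Instr (Add i i rOne)) (Suc 0) (I (Suc k)) s'"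
          unfolding s'
        proof (rule wp_Instr)
          show "exec_instr (Add i i rOne) (r', m') = Some (r'(i := of_nat (Suc k)), m')"
            using *(1) by (simp add: s' add.commute)
          show "numbers_in (r'(i := of_nat (Suc k)), m') \<subseteq> G"
            using *(2) nats'[OF k(1)] by (simp add: s' numbers_in_upd)
        qed (use * in \<open>simp_all add: s'\<close>)
      qed
      then show "holds (Less i b) s \<and> wp G (Seq c (Instr (Add i i rOne))) (T + Suc 0) (I (Suc k)) s"
        using counter[of k r m] k by (simp add: s)
    next
      fix s assume "I N s"
      then show "\<not> holds (Less i b) s"
        using counter[of N "fst s" "snd s"] by (cases s) simp
    qed (use start in auto)
    show "numbers_in (r(i := 0), m) \<subseteq> G" by fact
  qed (use start in auto)
  then show ?thesis by (simp add: algebra_simps)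
qed

text \<open>
  Loops for inner products and traces.  The body sees the exact partial sum in the accumulator,
  because its encoding length has to be controlled too.
\<close>

lemma wp_sum_loop:
  assumes start: "numbers_in (r, m) \<subseteq> G" "r b = of_nat N" "r rOne = 1"
    and nats: "\<And>k. k \<le> N \<Longrightarrow> of_nat k \<in> G"
    and regs: "i \<notin> {b, rOne, rAcc} \<union> X" "{b, rOne} \<inter> insert rAcc X = {}"
    and body: "\<And>l r'. l < N \<Longrightarrow> agree_off (insert i (insert rAcc X)) r r' \<Longrightarrow> r' i = of_nat l \<Longrightarrow>
      r' rAcc = r rAcc + (\<Sum>k<l. f k) \<Longrightarrow> numbers_in (r', m) \<subseteq> G \<Longrightarrow>
      wp G c T (\<lambda>(r'', m'). m' = m \<and> r'' rAcc = r' rAcc + f l \<and>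
        agree_off (insert rAcc X) r' r'') (r', m)"
  shows "wp G (For i b c) (N * (T + 2) + 2)
    (\<lambda>(r', m'). m' = m \<and> r' rAcc = r rAcc + (\<Sum>k<N. f k) \<and> agree_off (insert i (insert rAcc X)) r r')
    (r, m)"
proof -
  define I where "I k s \<longleftrightarrow> (case s of (r', m') \<Rightarrow> m' = m \<and> r' i = of_nat k \<and>
    r' rAcc = r rAcc + (\<Sum>l<k. f l) \<and> agree_off (insert i (insert rAcc X)) r r')" for k s
  have "wp G (For i b c) (N * (T + 2) + 2) (I N) (r, m)"
  proof (rule wp_For)
    show "I 0 (r(i := 0), m)" using regs by (auto simp: I_def agree_off_def)
    show "r' i = of_nat k \<and> r' b = of_nat N" if "I k (r', m')" for k r' m'
      using that regs start by (auto simp: I_def agree_off_def)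
    fix k r' m' assume k: "k < N" and *: "I k (r', m')" and G: "numbers_in (r', m') \<subseteq> G"
    have "wp G c T (\<lambda>(r'', m'). m' = m \<and> r'' rAcc = r' rAcc + f k \<and>
      agree_off (insert rAcc X) r' r'')
        (r', m')"
      using * body[OF k, of r'] G by (simp add: I_def)
    then show "wp G c T (\<lambda>(r'', m'). r'' i = of_nat k \<and> r'' rOne = 1 \<and>
        I (Suc k) (r''(i := of_nat (Suc k)), m')) (r', m')"
    proof (rule wp_mono)
      fix s assume s: "case s of (r'', m') \<Rightarrow>
        m' = m \<and> r'' rAcc = r' rAcc + f k \<and> agree_off (insert rAcc X) r' r''"
      obtain r'' where [simp]: "s = (r'', m)" using s by (cases s) auto
      have "r'' i = of_nat k" "r'' rOne = 1"
        using s * regs start by (auto simp: I_def agree_off_def)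
      moreover have "agree_off (insert i (insert rAcc X)) r r''"
        using s * by (auto simp: I_def intro: agree_off_trans)
      ultimately show "case s of (r'', m') \<Rightarrow> r'' i = of_nat k \<and> r'' rOne = 1 \<and>
        I (Suc k) (r''(i := of_nat (Suc k)), m')"
        using s * regs by (auto simp: I_def intro: agree_off_upd)
    qed simp
  qed (use start nats in auto)
  then show ?thesis
    by (rule wp_mono) (auto simp: I_def)
qed

lemma wp_append_loop:
  assumes start: "numbers_in (r, mem_of zs) \<subseteq> G" "r b = of_nat N" "r rOne = 1"
      "r rFree = of_nat (length zs)"
    and nats: "\<And>k. k \<le> N \<Longrightarrow> of_nat k \<in> G"
    and regs: "i \<notin> {b, rOne, rFree} \<union> X" "{b, rOne} \<inter> insert rFree X = {}"
    and body: "\<And>j r' ys. j < N \<Longrightarrow> agree_off (insert i (insert rFree X)) r r' \<Longrightarrow> r' i = of_nat j \<Longrightarrow>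
      ys = zs @ concat (map f [0..<j]) \<Longrightarrow> r' rFree = of_nat (length ys) \<Longrightarrow>
      numbers_in (r', mem_of ys) \<subseteq> G \<Longrightarrow>
      wp G c T (\<lambda>(r'', m'). m' = mem_of (ys @ f j) \<and> r'' rFree = of_nat (length (ys @ f j)) \<and>
        agree_off (insert rFree X) r' r'') (r', mem_of ys)"
  shows "wp G (For i b c) (N * (T + 2) + 2)
    (\<lambda>(r', m'). m' = mem_of (zs @ concat (map f [0..<N])) \<and>
      r' rFree = of_nat (length (zs @ concat (map f [0..<N]))) \<and>
        agree_off (insert i (insert rFree X)) r r')
    (r, mem_of zs)"
proof -
  define I where "I k s \<longleftrightarrow> (case s of (r', m') \<Rightarrow> m' = mem_of (zs @ concat (map f [0..<k])) \<and>
    r' i = of_nat k \<and> r' rFree = of_nat (length (zs @ concat (map f [0..<k]))) \<and>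
    agree_off (insert i (insert rFree X)) r r')" for k s
  have "wp G (For i b c) (N * (T + 2) + 2) (I N) (r, mem_of zs)"
  proof (rule wp_For)
    show "I 0 (r(i := 0), mem_of zs)" using regs start by (auto simp: I_def agree_off_def)
    show "r' i = of_nat k \<and> r' b = of_nat N" if "I k (r', m')" for k r' m'
      using that regs start by (auto simp: I_def agree_off_def)
    fix k r' m' assume k: "k < N" and *: "I k (r', m')" and G: "numbers_in (r', m') \<subseteq> G"
    define ys where "ys = zs @ concat (map f [0..<k])"
    have m': "m' = mem_of ys" using * by (simp add: I_def ys_def)
    have "wp G c T (\<lambda>(r'', m'). m' = mem_of (ys @ f k) \<and> r'' rFree = of_nat (length (ys @ f k)) \<and>
        agree_off (insert rFree X) r' r'') (r', mem_of ys)"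
      using * G unfolding m' by (intro body[OF k]) (auto simp: I_def ys_def)
    then show "wp G c T (\<lambda>(r'', m'). r'' i = of_nat k \<and> r'' rOne = 1 \<and>
        I (Suc k) (r''(i := of_nat (Suc k)), m')) (r', m')"
      unfolding m'
    proof (rule wp_mono)
      fix s assume s: "case s of (r'', m') \<Rightarrow> m' = mem_of (ys @ f k) \<and>
        r'' rFree = of_nat (length (ys @ f k)) \<and> agree_off (insert rFree X) r' r''"
      obtain r'' where [simp]: "s = (r'', mem_of (ys @ f k))" using s by (cases s) auto
      have "r'' i = of_nat k" "r'' rOne = 1"
        using s * regs start by (auto simp: I_def agree_off_def)
      moreover have "agree_off (insert i (insert rFree X)) r r''"
        using s * by (auto simp: I_def intro: agree_off_trans)
      moreover have "zs @ concat (map f [0..<Suc k]) = ys @ f k" by (simp add: ys_def)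
      ultimately show "case s of (r'', m') \<Rightarrow> r'' i = of_nat k \<and> r'' rOne = 1 \<and>
        I (Suc k) (r''(i := of_nat (Suc k)), m')"
        using s * regs unfolding I_def by (auto intro: agree_off_upd simp del: upt_Suc append_assoc)
    qed simp
  qed (use start nats in auto)
  then show ?thesis
    by (rule wp_mono) (auto simp: I_def)
qed

definition mat_list :: "nat \<Rightarrow> rat mat \<Rightarrow> rat list" where
  "mat_list n B = concat (map (\<lambda>i. map (\<lambda>j. B $$ (i, j)) [0..<n]) [0..<n])"

lemma length_concat_upt:
  "(\<And>i. i < N \<Longrightarrow> length (f i) = L) \<Longrightarrow> length (concat (map f [0..<N])) = N * L"
  by (induction N) auto

lemma nth_concat_upt:
  assumes "i < N" "k < length (f i)"
  shows "concat (map f [0..<N]) ! (length (concat (map f [0..<i])) + k) = f i ! k"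
    and "length (concat (map f [0..<i])) + k < length (concat (map f [0..<N]))"
proof -
  have "[0..<N] = [0..<i] @ i # [Suc i..<N]"
    using upt_add_eq_append[of 0 i "N - i"] assms(1) by (simp add: upt_conv_Cons)
  then have *: "concat (map f [0..<N]) = concat (map f [0..<i]) @ f i @ concat (map f [Suc i..<N])"
    by simp
  then show "concat (map f [0..<N]) ! (length (concat (map f [0..<i])) + k) = f i ! k"
    using assms(2) by (simp only: nth_append) simp
  show "length (concat (map f [0..<i])) + k < length (concat (map f [0..<N]))"
    unfolding * using assms(2) by simp
qed

lemma nth_concat_upt_const:
  assumes "i < N" "k < L" "\<And>i. i < N \<Longrightarrow> length (f i) = L"
  shows "concat (map f [0..<N]) ! (i * L + k) = f i ! k"
  using nth_concat_upt(1)[of i N k f] length_concat_upt[of i f L] assms by simp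

lemma length_mat_list [simp]: "length (mat_list n B) = n * n"
  unfolding mat_list_def by (rule length_concat_upt) simp

lemma nth_mat_list:
  assumes "i < n" "j < n"
  shows "mat_list n B ! (i * n + j) = B $$ (i, j)"
  unfolding mat_list_def using assms
  by (subst nth_concat_upt_const) auto

text \<open>
  Both phases of the program fill a matrix entry by entry.  The body is told how much of the
  matrix has been written, since this determines the address of the cell that it appends.
\<close>

lemma wp_append_matrix:
  assumes start: "numbers_in (r, mem_of zs) \<subseteq> G" "r rN = of_nat n" "r rOne = 1"
      "r rFree = of_nat (length zs)"
    and nats: "\<And>k. k \<le> n \<Longrightarrow> of_nat k \<in> G"
    and regs: "{rN, rOne, rI, rJ, rFree} \<inter> X = {}"
    and body: "\<And>i j r' ys. i < n \<Longrightarrow> j < n \<Longrightarrow> agree_off ({rI, rJ, rFree} \<union> X) r r' \<Longrightarrow>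
      r' rI = of_nat i \<Longrightarrow> r' rJ = of_nat j \<Longrightarrow> r' rFree = of_nat (length (zs @ ys)) \<Longrightarrow>
      length ys = i * n + j \<Longrightarrow> numbers_in (r', mem_of (zs @ ys)) \<subseteq> G \<Longrightarrow>
      wp G c T (\<lambda>(r'', m'). m' = mem_of (zs @ ys @ [B $$ (i, j)]) \<and> r'' rFree = r' rFree + 1 \<and>
        agree_off ({rFree} \<union> X) r' r'') (r', mem_of (zs @ ys))"
  shows "wp G (For rI rN (For rJ rN c)) (n * ((n * (T + 2) + 2) + 2) + 2)
    (\<lambda>(r', m'). m' = mem_of (zs @ mat_list n B) \<and> r' rFree = of_nat (length (zs @ mat_list n B)) \<and>
      agree_off ({rI, rJ, rFree} \<union> X) r r') (r, mem_of zs)"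
proof -
  have "wp G (For rI rN (For rJ rN c)) (n * ((n * (T + 2) + 2) + 2) + 2)
    (\<lambda>(r', m'). m' = mem_of (zs @ mat_list n B) \<and> r' rFree = of_nat (length (zs @ mat_list n B)) \<and>
      agree_off (insert rI (insert rFree (insert rJ X))) r r') (r, mem_of zs)"
    unfolding mat_list_def
  proof (rule wp_append_loop)
    fix i r' ys assume i: "i < n" "agree_off (insert rI (insert rFree (insert rJ X))) r r'"
      "r' rI = of_nat i" "ys = zs @ concat (map (\<lambda>i. map (\<lambda>j. B $$ (i, j)) [0..<n]) [0..<i])"
      "r' rFree = of_nat (length ys)" "numbers_in (r', mem_of ys) \<subseteq> G"
    have r': "r' rN = of_nat n" "r' rOne = 1"
      using agree_offD[OF i(2)] start regs by auto
    have "wp G (For rJ rN c) (n * (T + 2) + 2)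
        (\<lambda>(r'', m'). m' = mem_of (ys @ concat (map (\<lambda>j. [B $$ (i, j)]) [0..<n])) \<and>
          r'' rFree = of_nat (length (ys @ concat (map (\<lambda>j. [B $$ (i, j)]) [0..<n]))) \<and>
          agree_off (insert rJ (insert rFree X)) r' r'') (r', mem_of ys)"
    proof (rule wp_append_loop)
      fix j r'' ys' assume j: "j < n" "agree_off (insert rJ (insert rFree X)) r' r''"
        "r'' rJ = of_nat j" "ys' = ys @ concat (map (\<lambda>j. [B $$ (i, j)]) [0..<j])"
        "r'' rFree = of_nat (length ys')" "numbers_in (r'', mem_of ys') \<subseteq> G"
      define us where "us = concat (map (\<lambda>i. map (\<lambda>j. B $$ (i, j)) [0..<n]) [0..<i]) @
          concat (map (\<lambda>j. [B $$ (i, j)]) [0..<j])"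
      have ys': "ys' = zs @ us" by (simp add: us_def j i)
      have "length us = i * n + j"
        unfolding us_def by (subst length_append, subst length_concat_upt[of _ _ n]) auto
      moreover have "agree_off ({rI, rJ, rFree} \<union> X) r r''"
        using i(2) j(2) by (rule agree_off_trans) auto
      moreover have "r'' rI = of_nat i"
        using agree_offD[OF j(2), of rI] i regs by auto
      ultimately have "wp G c T (\<lambda>(s, m'). m' = mem_of (zs @ us @ [B $$ (i, j)]) \<and>
        s rFree = r'' rFree + 1 \<and>
          agree_off ({rFree} \<union> X) r'' s) (r'', mem_of (zs @ us))"
        using i(1) j unfolding ys' by (intro body) auto
      then show "wp G c T (\<lambda>(s, m'). m' = mem_of (ys' @ [B $$ (i, j)]) \<and>
          s rFree = of_nat (length (ys' @ [B $$ (i, j)])) \<and> agree_off (insert rFree X) r'' s) (r'',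
            mem_of ys')"
        unfolding ys' by (rule wp_mono) (auto simp: j(5) ys')
    qed (use i r' nats regs in auto)
    then show "wp G (For rJ rN c) (n * (T + 2) + 2)
        (\<lambda>(r'', m'). m' = mem_of (ys @ map (\<lambda>j. B $$ (i, j)) [0..<n]) \<and>
          r'' rFree = of_nat (length (ys @ map (\<lambda>j. B $$ (i, j)) [0..<n])) \<and>
          agree_off (insert rFree (insert rJ X)) r' r'') (r', mem_of ys)"
      by (simp add: insert_commute)
  qed (use start nats regs in auto)
  then show ?thesis by (simp add: insert_commute)
qed

lemma wp_blockI:
  "numbers_in (r, m) \<subseteq> G \<Longrightarrow> length as \<le> t \<Longrightarrow> steps G as Q r m \<Longrightarrow> wp G (block as) t Q (r, m)"
  by (rule wp_mono[OF wp_block]) auto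

lemma numbers_inD:
  "numbers_in (r, m) \<subseteq> G \<Longrightarrow> r a \<in> G"
  "numbers_in (r, m) \<subseteq> G \<Longrightarrow> m a \<in> G"
  by (auto simp: numbers_in_def)


section \<open>The program\<close>

declare coefficients.simps [simp del]

text \<open>
  The input lists the upper triangle column by column: \<open>1 + 2 + \<dots> + j\<close> entries precede column
  \<open>j\<close>, and every entry occupies \<open>d + 1\<close> cells.
\<close>

definition coeff_pos :: "nat \<Rightarrow> nat \<Rightarrow> nat \<Rightarrow> nat \<Rightarrow> nat" where
  "coeff_pos d i j k = ((Suc j choose 2) + i) * Suc d + k"

lemma of_nat_Suc_choose_2: "of_nat (Suc j choose 2) = ((of_nat j + 1) * of_nat j / 2 :: rat)"
proof -
  have "2 * (Suc j choose 2) = Suc j * j" by (simp add: choose_two)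
  then have "of_nat (2 * (Suc j choose 2)) = (of_nat (Suc j * j) :: rat)" by (simp only:)
  then show ?thesis by (simp add: algebra_simps)
qed

lemma nth_coefficients:
  assumes "i \<le> j" "j < n" "k \<le> d"
  shows "coefficients (n, d, P) ! coeff_pos d i j k = coeff (P $$ (i, j)) k"
    and "coeff_pos d i j k < length (coefficients (n, d, P))"
proof -
  define g where "g j = concat (map (\<lambda>i. map (\<lambda>k. coeff (P $$ (i,
    j)) k) [0..<Suc d]) [0..<Suc j])" for j
  have coeffs: "coefficients (n, d, P) = concat (map g [0..<n])" for n
    by (simp add: g_def[abs_def] coefficients.simps del: upt_Suc)
  have pos: "coeff_pos d i j k = length (concat (map g [0..<j])) + (i * Suc d + k)"
    unfolding coeffs[symmetric] length_coefficients by (simp add: coeff_pos_def algebra_simps)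
  have "length (g j) = Suc j * Suc d" unfolding g_def by (rule length_concat_upt) simp
  moreover have "i * Suc d + k < Suc i * Suc d" using assms by simp
  moreover have "Suc i * Suc d \<le> Suc j * Suc d" using assms by (intro mult_le_mono) auto
  ultimately have "i * Suc d + k < length (g j)" by linarith
  note nth = nth_concat_upt[of j n _ g, OF assms(2) this]
  have "g j ! (i * Suc d + k) = coeff (P $$ (i, j)) k"
    unfolding g_def using assms by (subst nth_concat_upt_const) (auto simp del: upt_Suc)
  then show "coefficients (n, d, P) ! coeff_pos d i j k = coeff (P $$ (i, j)) k"
    unfolding pos coeffs nth by simp
  show "coeff_pos d i j k < length (coefficients (n, d, P))"
    unfolding pos coeffs by (rule nth)
qed

text \<open>
  The address \<open>(j (j + 1) / 2 + i) (d + 1) + k\<close> is computed with rational division.  For entries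
  below the diagonal the two indices are exchanged.
\<close>

definition load_above :: "nat \<Rightarrow> nat \<Rightarrow> nat \<Rightarrow> com" where
  "load_above x a b = block
     [Add rT b rOne, Mul rT rT b, Div rT rT rTwo, Add rT rT a, Mul rT rT rD, Add rT rT rK,
       Load x rT]"

definition load_coeff :: "nat \<Rightarrow> nat \<Rightarrow> nat \<Rightarrow> com" where
  "load_coeff x a b = If (Less a b) (load_above x a b) (load_above x b a)"

definition load_cell :: "nat \<Rightarrow> nat \<Rightarrow> nat \<Rightarrow> nat \<Rightarrow> com" where
  "load_cell x b i j = block [Mul rT i rN, Add rT rT j, Add rT rT b, Load x rT]"

definition multiply_add :: com where
  "multiply_add = block [Mul rX rX rY, Add rAcc rAcc rX]"

definition append_acc :: com where
  "append_acc = block [Store rFree rAcc, Add rFree rFree rOne]"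

definition append_sum_of_squares :: com where
  "append_sum_of_squares =
     For rI rN (For rJ rN
       (Seq (block [Const rAcc 0])
       (Seq (For rK rD (For rL rN
              (Seq (load_coeff rX rI rL) (Seq (load_coeff rY rL rJ) multiply_add))))
            append_acc)))"

text \<open>
  One step of the recursion: the trace of \<open>N\<^sub>k\<close>, then \<open>c\<^sub>k\<close>, then \<open>N\<^bsub>k+1\<^esub>\<close>, each of whose
  entries starts as \<open>c\<^sub>k A\<^sub>i\<^sub>j\<close> and accumulates the inner product of a row of \<open>A\<close> and a column
  of \<open>N\<^sub>k\<close>.
\<close>

definition leverrier_step :: com where
  "leverrier_step =
     Seq (block [Mul rT rN rN, Mul rT rT rK, Add rCur rT rBase, Const rAcc 0])
    (Seq (For rI rN (Seq (load_cell rX rCur rI rI) (block [Add rAcc rAcc rX])))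
    (Seq (block [Add rT rK rOne, Div rC rAcc rT, Sub rC rZero rC])
         (For rI rN (For rJ rN
           (Seq (load_cell rX rBase rI rJ)
           (Seq (block [Mul rAcc rC rX])
           (Seq (For rL rN (Seq (load_cell rX rBase rI rL) (Seq (load_cell rY rCur rL rJ)
             multiply_add)))
                append_acc)))))))"

definition kernel_program :: com where
  "kernel_program =
     Seq (block [Const rOne 1, Const rTwo 2, Const rZero 0, Add rD rD rOne,
       Add rT rN rOne, Mul rT rT rN, Div rT rT rTwo, Mul rFree rT rD, Move rBase rFree])
    (Seq append_sum_of_squares
    (Seq (For rK rN leverrier_step)
         (If (Eq rC rZero) (block [Const rN 0]) (block [Const rN 1]))))"

lemma wp_load_cell:
  assumes G: "numbers_in (r, m) \<subseteq> G"
    and r: "r ri = of_nat i" "r rj = of_nat j" "r rN = of_nat n" "r rb = of_nat b"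
    and nats: "\<And>x. x \<le> b + (i * n + j) \<Longrightarrow> of_nat x \<in> G"
    and regs: "rT \<notin> {rj, rb, x}"
    and v: "m (b + (i * n + j)) = v"
  shows "wp G (load_cell x rb ri rj) 4
    (\<lambda>(r', m'). m' = m \<and> r' x = v \<and> agree_off {x, rT} r r') (r, m)"
proof -
  define a where "a = b + (i * n + j)"
  have a: "of_nat i * of_nat n + of_nat j + of_nat b = (of_nat a :: rat)" by (simp add: a_def)
  have "of_nat i * of_nat n \<in> G" "of_nat i * of_nat n + of_nat j \<in> G" "of_nat a \<in> G"
    using nats[of "i * n"] nats[of "i * n + j"] nats[of a] by (simp_all add: a_def)
  moreover have "m a = v" "v \<in> G" using v numbers_inD(2)[OF G, of a] by (simp_all add: a_def)
  ultimately show ?thesis unfolding load_cell_def using r regs G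
    by (intro wp_blockI) (auto simp: a agree_off_def)
qed

lemma wp_append_acc:
  assumes G: "numbers_in (r, mem_of ys) \<subseteq> G"
    and r: "r rFree = of_nat (length ys)" "r rOne = 1"
    and nats: "of_nat (Suc (length ys)) \<in> G"
  shows "wp G append_acc 2
    (\<lambda>(r', m'). m' = mem_of (ys @ [r rAcc]) \<and> r' rFree = r rFree + 1 \<and> agree_off {rFree} r r')
    (r, mem_of ys)"
proof -
  have "of_nat (length ys) + 1 \<in> G" using nats by (simp add: add.commute)
  then show ?thesis unfolding append_acc_def using r numbers_inD(1)[OF G, of rAcc]
    by (intro wp_blockI G) (auto simp: mem_of_snoc agree_off_def)
qed

text \<open>
  The time bounds follow the nesting of the program, in the form that the rules for loops and
  sequences produce.  They are polymorphic, so that the same expression over the type of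
  polynomials is the polynomial that bounds the running time.
\<close>

definition square_time :: "'a :: comm_semiring_1 \<Rightarrow> 'a \<Rightarrow> 'a" where
  "square_time n D =
     n * ((n * ((1 + ((D * ((n * ((8 + (8 + 2)) + 2) + 2) + 2) + 2) + 2)) + 2) + 2) + 2) + 2"

definition step_time :: "'a :: comm_semiring_1 \<Rightarrow> 'a" where
  "step_time n = 4 + ((n * ((4 + 1) + 2) + 2) + (3 +
     (n * ((n * ((4 + (1 + ((n * ((4 + (4 + 2)) + 2) + 2) + 2))) + 2) + 2) + 2) + 2)))"

definition total_time :: "'a :: comm_semiring_1 \<Rightarrow> 'a \<Rightarrow> 'a" where
  "total_time n D = 9 + (square_time n D + ((n * (step_time n + 2) + 2) + 2))"


section \<open>Correctness and running time of the program\<close>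

text \<open>
  The instance together with a set \<open>G\<close> that contains the input and all results of instructions:
  addresses and counters (\<open>nats\<close>), products, partial sums and quotients.  Values that are only
  loaded from memory are in \<open>G\<close> because they were in the previous state.
\<close>

locale kernel_run =
  fixes n d :: nat and P :: "rat poly mat" and G :: "rat set"
  assumes inst: "(n, d, P) \<in> sym_poly_matrices"
    and input: "set (coefficients (n, d, P)) \<subseteq> G"
    and nats: "\<And>x. x \<le> 2 * length (coefficients (n, d, P)) + n * n * (n + 1) \<Longrightarrow> of_nat x \<in> G"
    and square_term: "\<And>i j k l. i < n \<Longrightarrow> j < n \<Longrightarrow> l < n \<Longrightarrow> k \<le> d \<Longrightarrow>
      coeff (P $$ (i, l)) k * coeff (P $$ (l, j)) k \<in> G"
    and square_sum: "\<And>i j k l. i < n \<Longrightarrow> j < n \<Longrightarrow> l \<le> n \<Longrightarrow> k \<le> d \<Longrightarrow>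
      (\<Sum>k'<k. \<Sum>l'<n. coeff (P $$ (i, l')) k' * coeff (P $$ (l', j)) k') +
      (\<Sum>l'<l. coeff (P $$ (i, l')) k * coeff (P $$ (l', j)) k) \<in> G"
    and trace_sum: "\<And>k i. k < n \<Longrightarrow> i \<le> n \<Longrightarrow>
      (\<Sum>i'<i. leverrier_mat (sum_of_squares n d P) k $$ (i', i')) \<in> G"
    and leverrier_coeff: "\<And>k. k < n \<Longrightarrow> leverrier_coeff (sum_of_squares n d P) k \<in> G"
      "\<And>k. k < n \<Longrightarrow> - leverrier_coeff (sum_of_squares n d P) k \<in> G"
    and product_term: "\<And>i j k l. i < n \<Longrightarrow> j < n \<Longrightarrow> l < n \<Longrightarrow> k < n \<Longrightarrow>
      sum_of_squares n d P $$ (i, l) * leverrier_mat (sum_of_squares n d P) k $$ (l, j) \<in> G"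
    and product_sum: "\<And>i j k l. i < n \<Longrightarrow> j < n \<Longrightarrow> l \<le> n \<Longrightarrow> k < n \<Longrightarrow>
      leverrier_coeff (sum_of_squares n d P) k * sum_of_squares n d P $$ (i, j) +
      (\<Sum>l'<l. sum_of_squares n d P $$ (i, l') * leverrier_mat (sum_of_squares n d P) k $$ (l',
        j)) \<in> G"
begin

abbreviation "entries \<equiv> coefficients (n, d, P)"
abbreviation "len \<equiv> length entries"
abbreviation "A \<equiv> sum_of_squares n d P"
abbreviation "N \<equiv> leverrier_mat A"

lemma n_pos: "1 \<le> n"
  using inst by (simp add: sym_poly_matrices_def)

lemma P_symmetric: "i < n \<Longrightarrow> j < n \<Longrightarrow> P $$ (i, j) = P $$ (j, i)"
proof -
  assume "i < n" "j < n"
  moreover have "transpose_mat P = P" "P \<in> carrier_mat n n"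
    using inst by (auto simp: sym_poly_matrices_def)
  ultimately show ?thesis by (metis carrier_matD index_transpose_mat(1))
qed

lemma len_eq: "2 * len = (n * (n + 1)) * Suc d"
proof -
  have "2 * (Suc n choose 2) = n * (n + 1)" by (simp add: choose_two)
  then show ?thesis by (simp add: length_coefficients flip: mult.assoc)
qed

text \<open>
  Addresses are bounded in terms of the number of coefficients, so the matrix size and the
  degree are expressed by it.  An empty matrix would have no coefficients at all, whatever the
  degree.
\<close>

lemma small_le_len: "n * (n + 1) \<le> 2 * len" "n + 1 \<le> 2 * len" "Suc d \<le> len"
proof -
  show 1: "n * (n + 1) \<le> 2 * len" unfolding len_eq by simp
  show "n + 1 \<le> 2 * len" using 1 n_pos le_square[of n] unfolding distrib_left by linarith
  have "2 \<le> n * (n + 1)" using mult_le_mono[OF n_pos, of 2 "n + 1"] n_pos by simp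
  then have "2 * Suc d \<le> 2 * len" unfolding len_eq by (rule mult_le_mono) simp
  then show "Suc d \<le> len" by simp
qed

lemma wp_load_above:
  assumes G: "numbers_in (r, m) \<subseteq> G"
    and r: "r a = of_nat i" "r b = of_nat j" "r rK = of_nat k" "r rD = of_nat (Suc d)" "r rOne = 1"
      "r rTwo = 2"
    and ij: "i \<le> j" "j < n" "k \<le> d"
    and regs: "rT \<notin> {a, b, x}"
    and m: "m = mem_of (entries @ ys)"
  shows "wp G (load_above x a b) 7
    (\<lambda>(r', m'). m' = m \<and> r' x = coeff (P $$ (i, j)) k \<and> agree_off {x, rT} r r') (r, m)"
proof -
  define p where "p = coeff_pos d i j k"
  note p = nth_coefficients[of i j n k d P, OF ij, folded p_def]
  have "((of_nat j + 1) * of_nat j / 2 + of_nat i) * (1 + of_nat d) + of_nat k = (of_nat p :: rat)"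
    unfolding of_nat_Suc_choose_2[symmetric] by (simp add: p_def coeff_pos_def algebra_simps)
  moreover have "(of_nat j + 1) \<in> G"
    using nats[of "Suc j"] ij small_le_len(2) by (simp add: add.commute)
  moreover have "(of_nat j + 1) * of_nat j \<in> G"
  proof -
    have "Suc j * j \<le> n * (n + 1)" using ij mult_le_mono[of "Suc j" n j "n + 1"] by simp
    then show ?thesis
      using nats[of "Suc j * j"] small_le_len(1) by (simp add: algebra_simps)
  qed
  moreover have le: "((Suc j choose 2) + i) * Suc d + k < len" using p
    by (simp add: p_def coeff_pos_def)
  have "((Suc j choose 2) + i) * Suc d < len" using le by linarith
  then have "((of_nat j + 1) * of_nat j / 2 + of_nat i) * (1 + of_nat d) \<in> G"
    using nats[of "((Suc j choose 2) + i) * Suc d"]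
    unfolding of_nat_Suc_choose_2[symmetric] by (simp add: algebra_simps)
  moreover have le2: "(Suc j choose 2) + i < len"
    using le by (rule le_less_trans[rotated]) simp
  have "(of_nat j + 1) * of_nat j / 2 + of_nat i \<in> G"
    using nats[of "(Suc j choose 2) + i"] le2 by (simp flip: of_nat_Suc_choose_2)
  moreover have "(of_nat j + 1) * of_nat j / 2 \<in> G"
    using nats[of "Suc j choose 2"] le2 by (simp flip: of_nat_Suc_choose_2)
  moreover have "of_nat p \<in> G" using nats[of p] p by simp
  moreover have "m p = coeff (P $$ (i, j)) k" "coeff (P $$ (i, j)) k \<in> G"
    using p numbers_inD(2)[OF G, of p] by (simp_all add: m mem_of_append)
  ultimately show ?thesis unfolding load_above_def using r regs
    by (intro wp_blockI G) (auto simp: agree_off_def)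
qed

lemma wp_load_coeff:
  assumes G: "numbers_in (r, m) \<subseteq> G"
    and r: "r a = of_nat i" "r b = of_nat j" "r rK = of_nat k" "r rD = of_nat (Suc d)" "r rOne = 1"
      "r rTwo = 2"
    and ij: "i < n" "j < n" "k \<le> d"
    and regs: "rT \<notin> {a, b, x}"
    and m: "m = mem_of (entries @ ys)"
  shows "wp G (load_coeff x a b) 8
    (\<lambda>(r', m'). m' = m \<and> r' x = coeff (P $$ (i, j)) k \<and> agree_off {x, rT} r r') (r, m)"
proof -
  have "wp G (load_coeff x a b) (Suc 7)
    (\<lambda>(r', m'). m' = m \<and> r' x = coeff (P $$ (i, j)) k \<and> agree_off {x, rT} r r') (r, m)"
    unfolding load_coeff_def
  proof (rule wp_If[OF G])
    assume "holds (Less a b) (r, m)"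
    then show "wp G (load_above x a b) 7
        (\<lambda>(r', m'). m' = m \<and> r' x = coeff (P $$ (i, j)) k \<and> agree_off {x, rT} r r') (r, m)"
      using r ij regs m by (intro wp_load_above G) auto
  next
    assume "\<not> holds (Less a b) (r, m)"
    then show "wp G (load_above x b a) 7
        (\<lambda>(r', m'). m' = m \<and> r' x = coeff (P $$ (i, j)) k \<and> agree_off {x, rT} r r') (r, m)"
      unfolding P_symmetric[OF ij(1,2)] using r ij regs m by (intro wp_load_above G) auto
  qed
  then show ?thesis by simp
qed

lemma wp_multiply_add:
  assumes G: "numbers_in (r, m) \<subseteq> G" and "r rX * r rY \<in> G" "r rAcc + r rX * r rY \<in> G"
  shows "wp G multiply_add 2
    (\<lambda>(r', m'). m' = m \<and> r' rAcc = r rAcc + r rX * r rY \<and> agree_off {rAcc, rX} r r') (r, m)"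
  unfolding multiply_add_def using assms by (intro wp_blockI G) (auto simp: agree_off_def)


text \<open>
  The four nested loops are taken apart from the outside; \<open>r1, r2, \<dots>\<close> are the registers at
  increasing depth.  The invariant that matters is the value of the accumulator: within
  iteration \<open>l\<close> of the innermost loop it is a partial double sum, as in the assumption
  \<open>square_sum\<close>.
\<close>

lemma wp_append_sum_of_squares:
  assumes G: "numbers_in (r, mem_of entries) \<subseteq> G"
    and r: "r rN = of_nat n" "r rD = of_nat (Suc d)" "r rOne = 1" "r rTwo = 2" "r rFree = of_nat len"
  shows "wp G append_sum_of_squares (square_time n (Suc d))
    (\<lambda>(r', m'). m' = mem_of (entries @ mat_list n A) \<and> r' rFree = of_nat (len + n * n) \<and>
      agree_off {rI, rJ, rFree, rAcc, rK, rL, rX, rY, rT} r r') (r, mem_of entries)"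
proof -
  have "wp G append_sum_of_squares (square_time n (Suc d))
    (\<lambda>(r', m'). m' = mem_of (entries @ mat_list n A) \<and>
      r' rFree = of_nat (length (entries @ mat_list n A)) \<and>
      agree_off ({rI, rJ, rFree} \<union> {rAcc, rK, rL, rX, rY, rT}) r r') (r, mem_of entries)"
    unfolding append_sum_of_squares_def square_time_def
  proof (rule wp_append_matrix)
    show "of_nat k \<in> G" if "k \<le> n" for k
      using that small_le_len(2) by (intro nats) linarith
    fix i j r1 ys
    assume ij: "i < n" "j < n" and r1: "agree_off ({rI, rJ, rFree} \<union> {rAcc, rK, rL, rX, rY,
      rT}) r r1"
      "r1 rI = of_nat i" "r1 rJ = of_nat j" "r1 rFree = of_nat (length (entries @ ys))"
      and len: "length ys = i * n + j" and G1: "numbers_in (r1, mem_of (entries @ ys)) \<subseteq> G"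
    define m where "m = mem_of (entries @ ys)"
    have env1: "r1 rN = of_nat n" "r1 rD = of_nat (Suc d)" "r1 rOne = 1" "r1 rTwo = 2"
      using agree_offD[OF r1(1)] r by auto
    define f where "f k l = coeff (P $$ (i, l)) k * coeff (P $$ (l, j)) k" for k l
    show "wp G (Seq (block [Const rAcc 0])
       (Seq (For rK rD (For rL rN
              (Seq (load_coeff rX rI rL) (Seq (load_coeff rY rL rJ) multiply_add))))
            append_acc))
       (1 + ((Suc d * ((n * ((8 + (8 + 2)) + 2) + 2) + 2) + 2) + 2))
       (\<lambda>(r', m'). m' = mem_of (entries @ ys @ [A $$ (i, j)]) \<and> r' rFree = r1 rFree + 1 \<and>
         agree_off ({rFree} \<union> {rAcc, rK, rL, rX, rY, rT}) r1 r') (r1, mem_of (entries @ ys))"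
      unfolding m_def[symmetric]
    proof (rule wp_SeqI)
      show "wp G (block [Const rAcc 0]) 1 (\<lambda>s. s = (r1(rAcc := 0), m)) (r1, m)"
        using G1 nats[of 0] by (intro wp_blockI) (auto simp: m_def)
    next
      fix s assume s: "s = (r1(rAcc := 0), m)" and "numbers_in s \<subseteq> G"
      then have G2: "numbers_in (r1(rAcc := 0), m) \<subseteq> G" by simp
      show "wp G (Seq (For rK rD (For rL rN
              (Seq (load_coeff rX rI rL) (Seq (load_coeff rY rL rJ) multiply_add))))
            append_acc) ((Suc d * ((n * ((8 + (8 + 2)) + 2) + 2) + 2) + 2) + 2)
         (\<lambda>(r', m'). m' = mem_of (entries @ ys @ [A $$ (i, j)]) \<and> r' rFree = r1 rFree + 1 \<and>
         agree_off ({rFree} \<union> {rAcc, rK, rL, rX, rY, rT}) r1 r') s"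
        unfolding s
      proof (rule wp_SeqI, rule wp_sum_loop)
        fix k r2 assume k: "k < Suc d" and r2: "agree_off (insert rK (insert rAcc {rL, rX, rY,
          rT})) (r1(rAcc := 0)) r2"
          "r2 rK = of_nat k" "r2 rAcc = (r1(rAcc := 0)) rAcc + (\<Sum>k'<k. \<Sum>l<n. f k' l)"
          and G3: "numbers_in (r2, m) \<subseteq> G"
        have env2: "r2 rN = of_nat n" "r2 rD = of_nat (Suc d)" "r2 rOne = 1" "r2 rTwo = 2"
          "r2 rI = of_nat i" "r2 rJ = of_nat j"
          using agree_offD[OF r2(1)] env1 r1 by auto
        have "wp G (For rL rN (Seq (load_coeff rX rI rL) (Seq (load_coeff rY rL rJ) multiply_add)))
          (n * ((8 + (8 + 2)) + 2) + 2)
          (\<lambda>(r', m'). m' = m \<and> r' rAcc = r2 rAcc + (\<Sum>l<n. f k l) \<and>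
            agree_off (insert rL (insert rAcc {rX, rY, rT})) r2 r') (r2, m)"
        proof (rule wp_sum_loop)
          fix l r3 assume l: "l < n" and r3: "agree_off (insert rL (insert rAcc {rX, rY,
            rT})) r2 r3"
            "r3 rL = of_nat l" "r3 rAcc = r2 rAcc + (\<Sum>l'<l. f k l')"
            and G4: "numbers_in (r3, m) \<subseteq> G"
          have env3: "r3 rN = of_nat n" "r3 rD = of_nat (Suc d)" "r3 rOne = 1" "r3 rTwo = 2"
            "r3 rI = of_nat i" "r3 rJ = of_nat j" "r3 rK = of_nat k"
            using agree_offD[OF r3(1)] env2 r2 by auto
          show "wp G (Seq (load_coeff rX rI rL) (Seq (load_coeff rY rL rJ)
            multiply_add)) (8 + (8 + 2))
            (\<lambda>(r', m'). m' = m \<and> r' rAcc = r3 rAcc + f k l \<and>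
              agree_off (insert rAcc {rX, rY, rT}) r3 r') (r3, m)"
          proof (rule wp_SeqI)
            show "wp G (load_coeff rX rI rL) 8 (\<lambda>(r', m'). m' = m \<and> r' rX = coeff (P $$ (i, l)) k \<and>
                agree_off {rX, rT} r3 r') (r3, m)"
              using G4 env3 r3 ij l k by (intro wp_load_coeff) (auto simp: m_def)
            fix s assume s: "case s of (r', m') \<Rightarrow> m' = m \<and> r' rX = coeff (P $$ (i, l)) k \<and>
                agree_off {rX, rT} r3 r'" and "numbers_in s \<subseteq> G"
            then obtain r4 where s4: "s = (r4, m)" "r4 rX = coeff (P $$ (i, l)) k" "agree_off {rX,
              rT} r3 r4"
              and G5: "numbers_in (r4, m) \<subseteq> G" by auto
            have env4: "r4 rN = of_nat n" "r4 rD = of_nat (Suc d)" "r4 rOne = 1" "r4 rTwo = 2"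
              "r4 rL = of_nat l" "r4 rJ = of_nat j" "r4 rK = of_nat k"
              using agree_offD[OF s4(3)] env3 r3 by auto
            show "wp G (Seq (load_coeff rY rL rJ) multiply_add) (8 + 2)
              (\<lambda>(r', m'). m' = m \<and> r' rAcc = r3 rAcc + f k l \<and>
                agree_off (insert rAcc {rX, rY, rT}) r3 r') s"
              unfolding s4
            proof (rule wp_SeqI)
              show "wp G (load_coeff rY rL rJ) 8 (\<lambda>(r', m'). m' = m \<and> r' rY = coeff (P $$ (l,
                j)) k \<and>
                  agree_off {rY, rT} r4 r') (r4, m)"
                using G5 env4 ij l k by (intro wp_load_coeff) (auto simp: m_def)
              fix s' assume s': "case s' of (r', m') \<Rightarrow> m' = m \<and> r' rY = coeff (P $$ (l, j)) k \<and>
                  agree_off {rY, rT} r4 r'" and "numbers_in s' \<subseteq> G"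
              then obtain r5 where s5: "s' = (r5, m)" "r5 rY = coeff (P $$ (l,
                j)) k" "agree_off {rY, rT} r4 r5"
                and G6: "numbers_in (r5, m) \<subseteq> G" by auto
              have off5: "agree_off {rX, rY, rT} r3 r5"
                using s4(3) s5(3) by (rule agree_off_trans) auto
              have "r5 rX = coeff (P $$ (i, l)) k" using agree_offD[OF s5(3)] s4 by auto
              then have prod: "r5 rX * r5 rY = f k l" by (simp add: s5 f_def)
              have "r5 rAcc = (\<Sum>k'<k. \<Sum>l'<n. f k' l') + (\<Sum>l'<l. f k l')"
                using agree_offD[OF off5] r2 r3 by simp
              then have acc: "r5 rAcc + r5 rX * r5 rY = (\<Sum>k'<k. \<Sum>l'<n. f k' l') + (\<Sum>l'<Suc l. f k l')"
                by (simp add: prod)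
              have "wp G multiply_add 2
                (\<lambda>(r', m'). m' = m \<and> r' rAcc = r5 rAcc + r5 rX * r5 rY \<and> agree_off {rAcc,
                  rX} r5 r') (r5, m)"
              proof (rule wp_multiply_add[OF G6])
                show "r5 rX * r5 rY \<in> G" unfolding prod f_def using square_term ij l k by simp
                show "r5 rAcc + r5 rX * r5 rY \<in> G" unfolding acc f_def
                  using ij l k by (intro square_sum) auto
              qed
              then show "wp G multiply_add 2
                (\<lambda>(r', m'). m' = m \<and> r' rAcc = r3 rAcc + f k l \<and>
                  agree_off (insert rAcc {rX, rY, rT}) r3 r') s'"
                unfolding s5(1)
                by (rule wp_mono)
                  (use prod agree_offD[OF off5, of rAcc] in \<open>auto intro: agree_off_trans[OF off5]\<close>)
            qed
          qed
        qed (use G3 env2 small_le_len in \<open>auto intro!: nats\<close>)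
        then show "wp G (For rL rN (Seq (load_coeff rX rI rL) (Seq (load_coeff rY rL rJ)
          multiply_add)))
          (n * ((8 + (8 + 2)) + 2) + 2)
          (\<lambda>(r', m'). m' = m \<and> r' rAcc = r2 rAcc + (\<Sum>l<n. f k l) \<and>
            agree_off (insert rAcc {rL, rX, rY, rT}) r2 r') (r2, m)"
          by (simp add: insert_commute)
      next
        fix s assume s: "case s of (r', m') \<Rightarrow> m' = m \<and>
          r' rAcc = (r1(rAcc := 0)) rAcc + (\<Sum>k<Suc d. \<Sum>l<n. f k l) \<and>
          agree_off (insert rK (insert rAcc {rL, rX, rY, rT})) (r1(rAcc := 0)) r'"
          and "numbers_in s \<subseteq> G"
        then obtain r2 where r2: "s = (r2, m)" "r2 rAcc = (\<Sum>k<Suc d. \<Sum>l<n. f k l)"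
          "agree_off (insert rK (insert rAcc {rL, rX, rY, rT})) (r1(rAcc := 0)) r2"
          and G2: "numbers_in (r2, m) \<subseteq> G" by auto
        have off2: "agree_off {rAcc, rK, rL, rX, rY, rT} r1 r2"
          using r2(3) by (auto simp: agree_off_def)
        have "r2 rAcc = A $$ (i, j)" using ij
          by (simp add: r2 sum_of_squares_def f_def del: sum.lessThan_Suc)
        moreover have "wp G append_acc 2
          (\<lambda>(r', m'). m' = mem_of ((entries @ ys) @ [r2 rAcc]) \<and> r' rFree = r2 rFree + 1 \<and>
            agree_off {rFree} r2 r')
          (r2, m)"
          unfolding m_def
        proof (rule wp_append_acc)
          show "of_nat (Suc (length (entries @ ys))) \<in> G"
          proof (rule nats)
            have "i * n + j < n * n" using mult_le_mono[of "Suc i" n n n] ij by simp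
            then show "Suc (length (entries @ ys)) \<le> 2 * len + n * n * (n + 1)"
              by (simp add: len algebra_simps)
          qed
        qed (use G2 agree_offD[OF off2] r1 env1 in \<open>auto simp: m_def\<close>)
        ultimately show "wp G append_acc 2
           (\<lambda>(r', m'). m' = mem_of (entries @ ys @ [A $$ (i, j)]) \<and> r' rFree = r1 rFree + 1 \<and>
           agree_off ({rFree} \<union> {rAcc, rK, rL, rX, rY, rT}) r1 r') s"
          unfolding r2(1)
          by - (erule wp_mono, use agree_offD[OF off2,
            of rFree] in \<open>auto intro: agree_off_trans[OF off2]\<close>)
      qed (use G2 env1 small_le_len in \<open>auto intro!: nats\<close>)
    qed
  qed (use G r in auto)
  then show ?thesis by (rule wp_mono) (auto simp: agree_off_def)
qed

definition memory :: "nat \<Rightarrow> rat list" where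
  "memory k = entries @ concat (map (\<lambda>k. mat_list n (N k)) [0..<k])"

lemma memory_Suc: "memory (Suc k) = memory k @ mat_list n (N k)"
  by (simp add: memory_def)

lemma length_memory: "length (memory k) = len + k * (n * n)"
  by (induction k) (simp_all add: memory_Suc, simp add: memory_def)

text \<open>
  This keeps the loads within the part of the memory that has been written, and bounds all
  addresses by the final length of the memory.
\<close>

lemma cell_le:
  assumes "k' < k" "i < n" "j < n"
  shows "len + n * n * k' + (i * n + j) < len + n * n * k"
proof -
  have "i * n + j < n * n" using mult_le_mono[of "Suc i" n n n] assms by simp
  moreover have "n * n * Suc k' \<le> n * n * k" using assms by (intro mult_le_mono) auto
  ultimately show ?thesis by simp
qed

lemma mem_of_memory:
  assumes "k' < k" "i < n" "j < n"
  shows "mem_of (memory k @ ys) (len + n * n * k' + (i * n + j)) = N k' $$ (i, j)"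
proof -
  have ij: "i * n + j < n * n" using mult_le_mono[of "Suc i" n n n] assms by simp
  have "concat (map (\<lambda>k. mat_list n (N k)) [0..<k]) ! (k' * (n * n) + (i * n + j)) =
      mat_list n (N k') ! (i * n + j)"
    using assms(1) ij by (rule nth_concat_upt_const) simp
  also have "\<dots> = N k' $$ (i, j)" using assms by (intro nth_mat_list)
  finally have "concat (map (\<lambda>k. mat_list n (N k)) [0..<k]) !
    (n * n * k' + (i * n + j)) = N k' $$ (i, j)"
    by (simp add: mult.commute)
  moreover have "len + n * n * k' + (i * n + j) < length (memory k)"
    using cell_le[OF assms] by (simp add: length_memory mult.commute)
  ultimately show ?thesis
    by (simp add: mem_of_def memory_def nth_append add.assoc)
qed

lemma nats_cell:
  assumes "k < n" "i < n" "j < n" "x \<le> len + n * n * k + (i * n + j)"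
  shows "of_nat x \<in> G"
proof (rule nats)
  have "len + n * n * k + (i * n + j) < len + n * n * n" using assms by (intro cell_le)
  then show "x \<le> 2 * len + n * n * (n + 1)" using assms by (simp add: algebra_simps)
qed

text \<open>
  \<open>memory (Suc k)\<close> ends with \<open>N\<^sub>k\<close>, which starts at address \<open>cur\<close>, and \<open>A = N\<^sub>0\<close> follows the
  input.  While the entries of \<open>N\<^bsub>k+1\<^esub>\<close> are appended, both stay where they are, so the loads
  have known results.
\<close>

lemma wp_leverrier_step:
  assumes G: "numbers_in (r, mem_of (memory (Suc k))) \<subseteq> G"
    and r: "r rN = of_nat n" "r rOne = 1" "r rZero = 0" "r rK = of_nat k" "r rBase = of_nat len"
      "r rFree = of_nat (length (memory (Suc k)))"
    and k: "k < n"
  shows "wp G leverrier_step (step_time n)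
    (\<lambda>(r', m'). m' = mem_of (memory (Suc (Suc k))) \<and>
      r' rFree = of_nat (length (memory (Suc (Suc k)))) \<and>
      r' rC = leverrier_coeff A k \<and>
      agree_off {rI, rJ, rL, rAcc, rX, rY, rT, rFree, rCur, rC} r r') (r, mem_of (memory (Suc k)))"
  unfolding leverrier_step_def step_time_def
proof (rule wp_SeqI)
  define m where "m = mem_of (memory (Suc k))"
  define cur where "cur = len + n * n * k"
  let ?c = "leverrier_coeff A k"
  have nat_n: "of_nat x \<in> G" if "x \<le> n" for x
    using that small_le_len(2) by (intro nats) linarith
  have cell: "m (len + n * n * k' + (i * n + j)) = N k' $$ (i, j)" if "k' \<le>
    k" "i < n" "j < n" for k' i j
    using mem_of_memory[of k' "Suc k" i j "[]"] that by (simp add: m_def)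
  have "wp G (block [Mul rT rN rN, Mul rT rT rK, Add rCur rT rBase, Const rAcc 0]) 4
    (\<lambda>(r', m'). m' = m \<and> r' rCur = of_nat cur \<and> r' rAcc = 0 \<and> agree_off {rT, rCur, rAcc} r r') (r,
      m)"
  proof (rule wp_blockI)
    have "of_nat (n * n) \<in> G" by (rule nats) simp
    moreover have *: "of_nat x \<in> G" if "x \<le> cur" for x
      using nats_cell[of k 0 0 x] k that by (simp add: cur_def)
    have "of_nat (n * n * k) \<in> G" by (rule *) (simp add: cur_def)
    moreover have "of_nat n * of_nat n * of_nat k + of_nat len = (of_nat cur :: rat)"
      by (simp add: cur_def)
    ultimately show "steps G [Mul rT rN rN, Mul rT rT rK, Add rCur rT rBase, Const rAcc 0]
      (\<lambda>(r', m'). m' = m \<and> r' rCur = of_nat cur \<and> r' rAcc = 0 \<and> agree_off {rT, rCur,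
        rAcc} r r') r m"
      using r *[of cur] *[of 0] by (simp add: agree_off_def)
  qed (use G in \<open>simp_all add: m_def\<close>)
  then show "wp G (block [Mul rT rN rN, Mul rT rT rK, Add rCur rT rBase, Const rAcc 0]) 4
    (\<lambda>(r', m'). m' = m \<and> r' rCur = of_nat cur \<and> r' rAcc = 0 \<and> agree_off {rT, rCur, rAcc} r r')
    (r, mem_of (memory (Suc k)))" by (simp add: m_def)
  fix s assume "case s of (r', m') \<Rightarrow> m' = m \<and> r' rCur = of_nat cur \<and> r' rAcc = 0 \<and>
    agree_off {rT, rCur, rAcc} r r'" "numbers_in s \<subseteq> G"
  then obtain r1 where s: "s = (r1, m)" and r1: "r1 rCur = of_nat cur" "r1 rAcc = 0"
    "agree_off {rT, rCur, rAcc} r r1" and G1: "numbers_in (r1, m) \<subseteq> G"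
    by auto
  have env1: "r1 rN = of_nat n" "r1 rOne = 1" "r1 rZero = 0" "r1 rK = of_nat k" "r1 rBase = of_nat len"
      "r1 rFree = of_nat (length (memory (Suc k)))"
    using agree_offD[OF r1(3)] r by auto
  show "wp G (Seq (For rI rN (Seq (load_cell rX rCur rI rI) (block [Add rAcc rAcc rX])))
    (Seq (block [Add rT rK rOne, Div rC rAcc rT, Sub rC rZero rC])
         (For rI rN (For rJ rN
           (Seq (load_cell rX rBase rI rJ)
           (Seq (block [Mul rAcc rC rX])
           (Seq (For rL rN (Seq (load_cell rX rBase rI rL) (Seq (load_cell rY rCur rL rJ)
             multiply_add)))
                append_acc)))))))
    ((n * ((4 + 1) + 2) + 2) + (3 +
     (n * ((n * ((4 + (1 + ((n * ((4 + (4 + 2)) + 2) + 2) + 2))) + 2) + 2) + 2) + 2)))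
    (\<lambda>(r', m'). m' = mem_of (memory (Suc (Suc k))) \<and>
      r' rFree = of_nat (length (memory (Suc (Suc k)))) \<and>
      r' rC = ?c \<and>
      agree_off {rI, rJ, rL, rAcc, rX, rY, rT, rFree, rCur, rC} r r') s"
    unfolding s
  proof (rule wp_SeqI, rule wp_sum_loop)
    fix i r2 assume i: "i < n" and r2: "agree_off (insert rI (insert rAcc {rX, rT})) r1 r2"
      "r2 rI = of_nat i" "r2 rAcc = r1 rAcc + (\<Sum>i<i. N k $$ (i, i))" and G2: "numbers_in (r2,
        m) \<subseteq> G"
    have env2: "r2 rN = of_nat n" "r2 rCur = of_nat cur" using agree_offD[OF r2(1)] env1 r1 by auto
    show "wp G (Seq (load_cell rX rCur rI rI) (block [Add rAcc rAcc rX])) (4 + 1)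
      (\<lambda>(r', m'). m' = m \<and> r' rAcc = r2 rAcc + N k $$ (i, i) \<and> agree_off (insert rAcc {rX,
        rT}) r2 r')
      (r2, m)"
    proof (rule wp_SeqI)
      show "wp G (load_cell rX rCur rI rI) 4
        (\<lambda>(r', m'). m' = m \<and> r' rX = N k $$ (i, i) \<and> agree_off {rX, rT} r2 r') (r2, m)"
        using r2 env2 i k nats_cell[of k i i] cell[of k i i]
        by (intro wp_load_cell[OF G2]) (auto simp: cur_def)
      fix s assume "case s of (r', m') \<Rightarrow> m' = m \<and> r' rX = N k $$ (i, i) \<and> agree_off {rX, rT} r2 r'"
        "numbers_in s \<subseteq> G"
      then obtain r3 where s3: "s = (r3, m)" "r3 rX = N k $$ (i, i)" "agree_off {rX, rT} r2 r3"
        and G3: "numbers_in (r3, m) \<subseteq> G" by auto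
      have acc: "r3 rAcc = r2 rAcc" using agree_offD[OF s3(3)] by simp
      have "r2 rAcc + N k $$ (i, i) = (\<Sum>i'<Suc i. N k $$ (i', i'))" by (simp add: r2 r1)
      also have "\<dots> \<in> G" using i k by (intro trace_sum) auto
      finally show "wp G (block [Add rAcc rAcc rX]) 1
        (\<lambda>(r', m'). m' = m \<and> r' rAcc = r2 rAcc + N k $$ (i, i) \<and> agree_off (insert rAcc {rX,
          rT}) r2 r') s"
        unfolding s3(1) using s3(2,3) acc by (intro wp_blockI G3) (auto simp: agree_off_def)
    qed
  next
    fix s assume "case s of (r', m') \<Rightarrow> m' = m \<and> r' rAcc = r1 rAcc + (\<Sum>i<n. N k $$ (i, i)) \<and>
      agree_off (insert rI (insert rAcc {rX, rT})) r1 r'" "numbers_in s \<subseteq> G"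
    then obtain r2 where s: "s = (r2, m)" and r2: "r2 rAcc = (\<Sum>i<n. N k $$ (i, i))"
      "agree_off {rI, rAcc, rX, rT} r1 r2" and G2: "numbers_in (r2, m) \<subseteq> G"
      by (auto simp: r1)
    have env2: "r2 rN = of_nat n" "r2 rOne = 1" "r2 rZero = 0" "r2 rK = of_nat k" "r2 rBase = of_nat len"
      "r2 rFree = of_nat (length (memory (Suc k)))" "r2 rCur = of_nat cur"
      using agree_offD[OF r2(2)] env1 r1 by auto
    have c: "- (r2 rAcc / (of_nat k + 1)) = ?c"
      by (simp add: r2 leverrier_coeff_eq[OF sum_of_squares_carrier] add.commute)
    show "wp G (Seq (block [Add rT rK rOne, Div rC rAcc rT, Sub rC rZero rC])
         (For rI rN (For rJ rN
           (Seq (load_cell rX rBase rI rJ)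
           (Seq (block [Mul rAcc rC rX])
           (Seq (For rL rN (Seq (load_cell rX rBase rI rL) (Seq (load_cell rY rCur rL rJ)
             multiply_add)))
                append_acc))))))
      (3 + (n * ((n * ((4 + (1 + ((n * ((4 + (4 + 2)) + 2) + 2) + 2))) + 2) + 2) + 2) + 2))
      (\<lambda>(r', m'). m' = mem_of (memory (Suc (Suc k))) \<and>
        r' rFree = of_nat (length (memory (Suc (Suc k)))) \<and>
      r' rC = ?c \<and>
      agree_off {rI, rJ, rL, rAcc, rX, rY, rT, rFree, rCur, rC} r r') s"
      unfolding s
    proof (rule wp_SeqI)
      have "of_nat (Suc k) \<in> G" using k by (intro nat_n) simp
      then have "of_nat k + 1 \<in> G" by (simp add: add.commute)
      moreover have "r2 rAcc / (of_nat k + 1) \<in> G" "?c \<in> G"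
        using leverrier_coeff[OF k] unfolding c[symmetric] minus_minus by simp_all
      moreover have "of_nat k + 1 \<noteq> (0 :: rat)"
        by (metis of_nat_Suc of_nat_neq_0 add.commute)
      ultimately show "wp G (block [Add rT rK rOne, Div rC rAcc rT, Sub rC rZero rC]) 3
        (\<lambda>(r', m'). m' = m \<and> r' rC = ?c \<and> agree_off {rT, rC} r2 r') (r2, m)"
        using env2 c by (intro wp_blockI G2) (auto simp: agree_off_def)
      fix s assume "case s of (r', m') \<Rightarrow> m' = m \<and> r' rC = ?c \<and> agree_off {rT, rC} r2 r'"
        "numbers_in s \<subseteq> G"
      then obtain r3 where s: "s = (r3, m)" and r3: "r3 rC = ?c" "agree_off {rT, rC} r2 r3"
        and G3: "numbers_in (r3, m) \<subseteq> G" by auto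
      have env3: "r3 rN = of_nat n" "r3 rOne = 1" "r3 rBase = of_nat len"
        "r3 rFree = of_nat (length (memory (Suc k)))" "r3 rCur = of_nat cur"
        using agree_offD[OF r3(2)] env2 by auto
      have off3: "agree_off {rI, rAcc, rX, rT, rCur, rC} r r3"
      proof (rule agree_off_trans)
        show "agree_off {rT, rCur, rAcc, rI, rX} r r2"
          using r1(3) r2(2) by (rule agree_off_trans) auto
      qed (use r3 in auto)
      have "wp G (For rI rN (For rJ rN
           (Seq (load_cell rX rBase rI rJ)
           (Seq (block [Mul rAcc rC rX])
           (Seq (For rL rN (Seq (load_cell rX rBase rI rL) (Seq (load_cell rY rCur rL rJ)
             multiply_add)))
                append_acc)))))
        (n * ((n * ((4 + (1 + ((n * ((4 + (4 + 2)) + 2) + 2) + 2))) + 2) + 2) + 2) + 2)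
        (\<lambda>(r', m'). m' = mem_of (memory (Suc k) @ mat_list n (N (Suc k))) \<and>
          r' rFree = of_nat (length (memory (Suc k) @ mat_list n (N (Suc k)))) \<and>
          agree_off ({rI, rJ, rFree} \<union> {rL, rAcc, rX, rY, rT}) r3 r') (r3, mem_of (memory (Suc k)))"
      proof (rule wp_append_matrix)
        fix i j r4 ys
        assume ij: "i < n" "j < n" and r4: "agree_off ({rI, rJ, rFree} \<union> {rL, rAcc, rX, rY,
          rT}) r3 r4"
          "r4 rI = of_nat i" "r4 rJ = of_nat j" "r4 rFree = of_nat (length (memory (Suc k) @ ys))"
          and ys: "length ys = i * n + j" and G4: "numbers_in (r4,
            mem_of (memory (Suc k) @ ys)) \<subseteq> G"
        define m' where "m' = mem_of (memory (Suc k) @ ys)"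
        have G4: "numbers_in (r4, m') \<subseteq> G" using G4 by (simp add: m'_def)
        have cell: "m' (len + n * n * k' + (i * n + j)) = N k' $$ (i, j)"
          if "k' \<le> k" "i < n" "j < n" for k' i j
          unfolding m'_def using that by (intro mem_of_memory) auto
        have cell_A: "m' (len + (i * n + j)) = A $$ (i, j)" if "i < n" "j < n" for i j
          using cell[of 0 i j] that by simp
        have nats_A: "of_nat x \<in> G" if "x \<le> len + (i * n + j)" "i < n" "j < n" for x i j
          using nats_cell[of 0 i j x] that by simp
        have env4: "r4 rN = of_nat n" "r4 rOne = 1" "r4 rBase = of_nat len"
          "r4 rCur = of_nat cur" "r4 rC = ?c"
          using agree_offD[OF r4(1)] env3 r3 by auto
        define f where "f l = A $$ (i, l) * N k $$ (l, j)" for l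
        have "wp G (Seq (load_cell rX rBase rI rJ)
           (Seq (block [Mul rAcc rC rX])
           (Seq (For rL rN (Seq (load_cell rX rBase rI rL) (Seq (load_cell rY rCur rL rJ)
             multiply_add)))
                append_acc))) (4 + (1 + ((n * ((4 + (4 + 2)) + 2) + 2) + 2)))
           (\<lambda>(r', u). u = mem_of (memory (Suc k) @ ys @ [N (Suc k) $$ (i, j)]) \<and>
             r' rFree = r4 rFree + 1 \<and>
             agree_off ({rFree} \<union> {rL, rAcc, rX, rY, rT}) r4 r') (r4, m')"
        proof (rule wp_SeqI)
          show "wp G (load_cell rX rBase rI rJ) 4
            (\<lambda>(r', u). u = m' \<and> r' rX = A $$ (i, j) \<and> agree_off {rX, rT} r4 r') (r4, m')"
            using r4 env4 ij cell_A[of i j] nats_A[of _ i j]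
            by (intro wp_load_cell[OF G4]) auto
          fix s assume "case s of (r', u) \<Rightarrow> u = m' \<and> r' rX = A $$ (i, j) \<and> agree_off {rX, rT} r4 r'"
            "numbers_in s \<subseteq> G"
          then obtain r5 where s: "s = (r5, m')" and r5: "r5 rX = A $$ (i, j)" "agree_off {rX,
            rT} r4 r5"
            and G5: "numbers_in (r5, m') \<subseteq> G" by auto
          have c5: "r5 rC = ?c" using agree_offD[OF r5(2)] env4 by simp
          show "wp G (Seq (block [Mul rAcc rC rX])
             (Seq (For rL rN (Seq (load_cell rX rBase rI rL) (Seq (load_cell rY rCur rL rJ)
               multiply_add)))
                append_acc)) (1 + ((n * ((4 + (4 + 2)) + 2) + 2) + 2))
             (\<lambda>(r', u). u = mem_of (memory (Suc k) @ ys @ [N (Suc k) $$ (i, j)]) \<and>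
               r' rFree = r4 rFree + 1 \<and>
             agree_off ({rFree} \<union> {rL, rAcc, rX, rY, rT}) r4 r') s"
            unfolding s
          proof (rule wp_SeqI)
            show "wp G (block [Mul rAcc rC rX]) 1
              (\<lambda>(r', u). u = m' \<and> r' rAcc = ?c * A $$ (i, j) \<and> agree_off {rAcc, rX, rT} r4 r') (r5,
                m')"
              using r5 c5 product_sum[OF ij, of 0 k] k
              by (intro wp_blockI G5) (auto simp: agree_off_def)
            fix s assume "case s of (r', u) \<Rightarrow> u = m' \<and> r' rAcc = ?c * A $$ (i, j) \<and>
              agree_off {rAcc, rX, rT} r4 r'" "numbers_in s \<subseteq> G"
            then obtain r6 where s: "s = (r6, m')" and r6: "r6 rAcc = ?c * A $$ (i, j)"
              "agree_off {rAcc, rX, rT} r4 r6" and G6: "numbers_in (r6, m') \<subseteq> G" by auto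
            have env6: "r6 rN = of_nat n" "r6 rOne = 1" "r6 rBase = of_nat len"
              "r6 rCur = of_nat cur" "r6 rI = of_nat i" "r6 rJ = of_nat j"
              using agree_offD[OF r6(2)] env4 r4 by auto
            show "wp G (Seq (For rL rN (Seq (load_cell rX rBase rI rL)
              (Seq (load_cell rY rCur rL rJ) multiply_add)))
                append_acc) ((n * ((4 + (4 + 2)) + 2) + 2) + 2)
              (\<lambda>(r', u). u = mem_of (memory (Suc k) @ ys @ [N (Suc k) $$ (i, j)]) \<and>
                r' rFree = r4 rFree + 1 \<and>
              agree_off ({rFree} \<union> {rL, rAcc, rX, rY, rT}) r4 r') s"
              unfolding s
            proof (rule wp_SeqI, rule wp_sum_loop)
              fix l r7 assume l: "l < n" and r7: "agree_off (insert rL (insert rAcc {rX, rY,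
                rT})) r6 r7"
                "r7 rL = of_nat l" "r7 rAcc = r6 rAcc + (\<Sum>l'<l. f l')" and G7: "numbers_in (r7,
                  m') \<subseteq> G"
              have env7: "r7 rN = of_nat n" "r7 rOne = 1" "r7 rBase = of_nat len"
                "r7 rCur = of_nat cur" "r7 rI = of_nat i" "r7 rJ = of_nat j"
                using agree_offD[OF r7(1)] env6 by auto
              show "wp G (Seq (load_cell rX rBase rI rL) (Seq (load_cell rY rCur rL rJ)
                multiply_add)) (4 + (4 + 2))
                (\<lambda>(r', u). u = m' \<and> r' rAcc = r7 rAcc + f l \<and> agree_off (insert rAcc {rX, rY,
                  rT}) r7 r')
                (r7, m')"
              proof (rule wp_SeqI)
                show "wp G (load_cell rX rBase rI rL) 4
                  (\<lambda>(r', u). u = m' \<and> r' rX = A $$ (i, l) \<and> agree_off {rX, rT} r7 r') (r7, m')"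
                  using r7 env7 ij l cell_A[of i l] nats_A[of _ i l]
                  by (intro wp_load_cell[OF G7]) auto
                fix s assume "case s of (r', u) \<Rightarrow> u = m' \<and> r' rX = A $$ (i, l) \<and> agree_off {rX,
                  rT} r7 r'"
                  "numbers_in s \<subseteq> G"
                then obtain r8 where s: "s = (r8, m')" and r8: "r8 rX = A $$ (i,
                  l)" "agree_off {rX, rT} r7 r8"
                  and G8: "numbers_in (r8, m') \<subseteq> G" by auto
                have env8: "r8 rN = of_nat n" "r8 rCur = of_nat cur" "r8 rL = of_nat l" "r8 rJ = of_nat j"
                  using agree_offD[OF r8(2)] env7 r7 by auto
                show "wp G (Seq (load_cell rY rCur rL rJ) multiply_add) (4 + 2)
                  (\<lambda>(r', u). u = m' \<and> r' rAcc = r7 rAcc + f l \<and> agree_off (insert rAcc {rX, rY,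
                    rT}) r7 r') s"
                  unfolding s
                proof (rule wp_SeqI)
                  show "wp G (load_cell rY rCur rL rJ) 4
                    (\<lambda>(r', u). u = m' \<and> r' rY = N k $$ (l, j) \<and> agree_off {rY, rT} r8 r') (r8, m')"
                    using env8 ij l k cell[of k l j] nats_cell[of k l j]
                    by (intro wp_load_cell[OF G8]) (auto simp: cur_def)
                  fix s assume "case s of (r', u) \<Rightarrow> u = m' \<and> r' rY = N k $$ (l, j) \<and> agree_off {rY,
                    rT} r8 r'"
                    "numbers_in s \<subseteq> G"
                  then obtain r9 where s: "s = (r9, m')" and r9: "r9 rY = N k $$ (l,
                    j)" "agree_off {rY, rT} r8 r9"
                    and G9: "numbers_in (r9, m') \<subseteq> G" by auto
                  have off9: "agree_off {rX, rY, rT} r7 r9"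
                    using r8(2) r9(2) by (rule agree_off_trans) auto
                  have prod: "r9 rX * r9 rY = f l"
                    using agree_offD[OF r9(2)] r8 r9 by (simp add: f_def)
                  have acc: "r9 rAcc + r9 rX * r9 rY = ?c * A $$ (i, j) + (\<Sum>l'<Suc l. f l')"
                    using agree_offD[OF off9, of rAcc] r7 r6 by (simp add: prod)
                  have "wp G multiply_add 2
                    (\<lambda>(r', u). u = m' \<and> r' rAcc = r9 rAcc + r9 rX * r9 rY \<and> agree_off {rAcc,
                      rX} r9 r')
                    (r9, m')"
                  proof (rule wp_multiply_add[OF G9])
                    show "r9 rX * r9 rY \<in> G" unfolding prod f_def using product_term ij l k by simp
                    show "r9 rAcc + r9 rX * r9 rY \<in> G" unfolding acc f_def
                      using ij l k by (intro product_sum) auto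
                  qed
                  then show "wp G multiply_add 2
                    (\<lambda>(r', u). u = m' \<and> r' rAcc = r7 rAcc + f l \<and> agree_off (insert rAcc {rX, rY,
                      rT}) r7 r') s"
                    unfolding s
                    by (rule wp_mono)
                      (use prod agree_offD[OF off9,
                        of rAcc] in \<open>auto intro: agree_off_trans[OF off9]\<close>)
                qed
              qed
            next
              fix s assume "case s of (r', u) \<Rightarrow> u = m' \<and> r' rAcc = r6 rAcc + (\<Sum>l<n. f l) \<and>
                agree_off (insert rL (insert rAcc {rX, rY, rT})) r6 r'" "numbers_in s \<subseteq> G"
              then obtain r7 where s: "s = (r7, m')" and r7: "r7 rAcc = r6 rAcc + (\<Sum>l<n. f l)"
                "agree_off (insert rL (insert rAcc {rX, rY, rT})) r6 r7"
                and G7: "numbers_in (r7, m') \<subseteq> G" by auto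
              have off7: "agree_off {rL, rAcc, rX, rY, rT} r4 r7"
                using r6(2) r7(2) by (rule agree_off_trans) auto
              have acc: "r7 rAcc = N (Suc k) $$ (i, j)"
                by (simp add: r7 r6 f_def index_leverrier_mat_Suc[OF sum_of_squares_carrier ij])
              have "wp G append_acc 2
                (\<lambda>(r', u). u = mem_of ((memory (Suc k) @ ys) @ [r7 rAcc]) \<and>
                  r' rFree = r7 rFree + 1 \<and>
                  agree_off {rFree} r7 r') (r7, m')"
                unfolding m'_def
              proof (rule wp_append_acc)
                show "of_nat (Suc (length (memory (Suc k) @ ys))) \<in> G"
                proof (rule nats)
                  have "len + n * n * Suc k + (i * n + j) < len + n * n * (n + 1)"
                    using ij k by (intro cell_le) auto
                  moreover have "length (memory (Suc k) @ ys) = len + n * n * Suc k + (i * n + j)"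
                    by (simp add: length_memory ys)
                  ultimately show "Suc (length (memory (Suc k) @ ys)) \<le> 2 * len + n * n * (n + 1)"
                    by linarith
                qed
              qed (use G7 agree_offD[OF off7] r4 env4 in \<open>auto simp: m'_def\<close>)
              then show "wp G append_acc 2
                (\<lambda>(r', u). u = mem_of (memory (Suc k) @ ys @ [N (Suc k) $$ (i, j)]) \<and>
                  r' rFree = r4 rFree + 1 \<and>
                agree_off ({rFree} \<union> {rL, rAcc, rX, rY, rT}) r4 r') s"
                unfolding s
                by (rule wp_mono)
                  (use acc agree_offD[OF off7, of rFree] in \<open>auto intro: agree_off_trans[OF off7]\<close>)
            qed (use G6 env6 nat_n in auto)
          qed
        qed
        then show "wp G (Seq (load_cell rX rBase rI rJ)
           (Seq (block [Mul rAcc rC rX])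
           (Seq (For rL rN (Seq (load_cell rX rBase rI rL) (Seq (load_cell rY rCur rL rJ)
             multiply_add)))
                append_acc))) (4 + (1 + ((n * ((4 + (4 + 2)) + 2) + 2) + 2)))
           (\<lambda>(r', u). u = mem_of (memory (Suc k) @ ys @ [N (Suc k) $$ (i, j)]) \<and>
             r' rFree = r4 rFree + 1 \<and>
             agree_off ({rFree} \<union> {rL, rAcc, rX, rY, rT}) r4 r') (r4, mem_of (memory (Suc k) @ ys))"
          by (simp add: m'_def)
      qed (use G3 env3 nat_n in \<open>auto simp: m_def\<close>)
      then show "wp G (For rI rN (For rJ rN
           (Seq (load_cell rX rBase rI rJ)
           (Seq (block [Mul rAcc rC rX])
           (Seq (For rL rN (Seq (load_cell rX rBase rI rL) (Seq (load_cell rY rCur rL rJ)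
             multiply_add)))
                append_acc)))))
        (n * ((n * ((4 + (1 + ((n * ((4 + (4 + 2)) + 2) + 2) + 2))) + 2) + 2) + 2) + 2)
        (\<lambda>(r', m'). m' = mem_of (memory (Suc (Suc k))) \<and>
          r' rFree = of_nat (length (memory (Suc (Suc k)))) \<and>
          r' rC = ?c \<and> agree_off {rI, rJ, rL, rAcc, rX, rY, rT, rFree, rCur, rC} r r') s"
        unfolding s m_def memory_Suc[of "Suc k"]
      proof (rule wp_mono)
        fix s' assume "case s' of (r', m') \<Rightarrow> m' = mem_of (memory (Suc k) @ mat_list n (N (Suc k))) \<and>
          r' rFree = of_nat (length (memory (Suc k) @ mat_list n (N (Suc k)))) \<and>
          agree_off ({rI, rJ, rFree} \<union> {rL, rAcc, rX, rY, rT}) r3 r'"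
        then obtain r' where s': "s' = (r', mem_of (memory (Suc k) @ mat_list n (N (Suc k))))"
          "r' rFree = of_nat (length (memory (Suc k) @ mat_list n (N (Suc k))))"
          "agree_off ({rI, rJ, rFree} \<union> {rL, rAcc, rX, rY, rT}) r3 r'" by auto
        have "agree_off {rI, rJ, rL, rAcc, rX, rY, rT, rFree, rCur, rC} r r'"
          using off3 s'(3) by (rule agree_off_trans) auto
        then show "case s' of (r', m') \<Rightarrow> m' = mem_of (memory (Suc k) @ mat_list n (N (Suc k))) \<and>
          r' rFree = of_nat (length (memory (Suc k) @ mat_list n (N (Suc k)))) \<and> r' rC = ?c \<and>
          agree_off {rI, rJ, rL, rAcc, rX, rY, rT, rFree, rCur, rC} r r'"
          using s' agree_offD[OF s'(3), of rC] r3 by simp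
      qed simp
    qed
  qed (use G1 env1 nat_n in auto)
qed


lemma wp_kernel_program:
  "wp G kernel_program (total_time n (Suc d)) (\<lambda>s. fst s 0 = (if det A = 0 then 0 else 1))
     (initial_state [n, d] entries)"
proof -
  define r where "r i = (if i < length [n, d] then of_nat ([n, d] ! i) else 0 :: rat)" for i
  have init: "initial_state [n, d] entries = (r, mem_of entries)"
    by (simp add: initial_state_def r_def[abs_def] mem_of_def)
  have r: "r rN = of_nat n" "r rD = of_nat d" by (simp_all add: r_def)
  have nat_n: "of_nat x \<in> G" if "x \<le> n" for x
    using that small_le_len(2) by (intro nats) linarith
  have G: "numbers_in (r, mem_of entries) \<subseteq> G"
  proof -
    have "r a \<in> G" for a
    proof (cases "a < 2")
      case True
      then have "a = 0 \<or> a = 1" by auto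
      then show ?thesis using r nat_n[of n] nats[of d] small_le_len by auto
    next
      case False
      then show ?thesis using nats[of 0] by (simp add: r_def)
    qed
    moreover have "mem_of entries a \<in> G" for a
      using input nats[of 0] by (auto simp: mem_of_def)
    ultimately show ?thesis by (auto simp: numbers_in_def)
  qed
  have len: "(of_nat n + 1) * of_nat n / 2 * (of_nat d + 1) = (of_nat len :: rat)"
    unfolding of_nat_Suc_choose_2[symmetric] by (simp add: length_coefficients algebra_simps)
  then have len': "(of_nat n + 1) * of_nat n * (of_nat d + 1) = (of_nat len * 2 :: rat)" by simp
  define env where "env r' \<longleftrightarrow> r' rN = of_nat n \<and> r' rOne = 1 \<and> r' rZero = 0 \<and> r' rBase = of_nat len"
    for r' :: "nat \<Rightarrow> rat"
  have "wp G kernel_program (9 + (square_time n (Suc d) + ((n * (step_time n + 2) + 2) + 2)))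
    (\<lambda>s. fst s 0 = (if det A = 0 then 0 else 1)) (r, mem_of entries)"
    unfolding kernel_program_def
  proof (rule wp_SeqI)
    have "of_nat (n + 1) \<in> G" "of_nat (d + 1) \<in> G" "of_nat len \<in> G"
      using small_le_len by (intro nats; simp)+
    moreover have "of_nat ((n + 1) * n) \<in> G"
      using small_le_len(1) by (intro nats) (simp add: algebra_simps)
    moreover have "of_nat (Suc n choose 2) \<in> G"
      by (rule nats) (simp add: length_coefficients)
    ultimately have "of_nat n + 1 \<in> G" "of_nat d + 1 \<in> G" "of_nat len \<in> G"
      "(of_nat n + 1) * of_nat n \<in> G" "(of_nat n + 1) * of_nat n / 2 \<in> G"
      by (simp_all add: of_nat_Suc_choose_2 algebra_simps)
    moreover have "(1 :: rat) \<in> G" "(0 :: rat) \<in> G" "(2 :: rat) \<in> G"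
      using nats[of 1] nats[of 0] nats[of 2] small_le_len n_pos by auto
    ultimately show "wp G (block [Const rOne 1, Const rTwo 2, Const rZero 0, Add rD rD rOne,
       Add rT rN rOne, Mul rT rT rN, Div rT rT rTwo, Mul rFree rT rD, Move rBase rFree]) 9
      (\<lambda>(r', m'). m' = mem_of entries \<and> env r' \<and> r' rD = of_nat (Suc d) \<and> r' rTwo = 2 \<and>
        r' rFree = of_nat len) (r, mem_of entries)"
      using r by (intro wp_blockI G) (auto simp: len' env_def)
    fix s assume "case s of (r', m') \<Rightarrow> m' = mem_of entries \<and> env r' \<and> r' rD = of_nat (Suc d) \<and>
      r' rTwo = 2 \<and> r' rFree = of_nat len" "numbers_in s \<subseteq> G"
    then obtain r1 where s: "s = (r1, mem_of entries)" and r1: "env r1" "r1 rD = of_nat (Suc d)"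
      "r1 rTwo = 2" "r1 rFree = of_nat len" and G1: "numbers_in (r1, mem_of entries) \<subseteq> G" by auto
    show "wp G (Seq append_sum_of_squares (Seq (For rK rN leverrier_step)
         (If (Eq rC rZero) (block [Const rN 0]) (block [Const rN 1]))))
      (square_time n (Suc d) + ((n * (step_time n + 2) + 2) + 2))
      (\<lambda>s. fst s 0 = (if det A = 0 then 0 else 1)) s"
      unfolding s
    proof (rule wp_SeqI, rule wp_append_sum_of_squares)
      fix s assume "case s of (r', m') \<Rightarrow> m' = mem_of (entries @ mat_list n A) \<and>
        r' rFree = of_nat (len + n * n) \<and> agree_off {rI, rJ, rFree, rAcc, rK, rL, rX, rY, rT} r1 r'"
        "numbers_in s \<subseteq> G"
      then obtain r2 where s: "s = (r2,
        mem_of (memory 1))" and r2: "r2 rFree = of_nat (length (memory 1))"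
        "agree_off {rI, rJ, rFree, rAcc, rK, rL, rX, rY, rT} r1 r2"
        and G2: "numbers_in (r2, mem_of (memory 1)) \<subseteq> G" by (auto simp: memory_def)
      have env2: "env r2" using agree_offD[OF r2(2)] r1 by (simp add: env_def)
      \<comment> \<open>Before the first iteration \<open>rC\<close> holds no coefficient; since \<open>n \<ge> 1\<close>, it holds the last one
        when the loop ends.\<close>
      define I where "I k s \<longleftrightarrow> (case s of (r', m') \<Rightarrow> env r' \<and> r' rK = of_nat k \<and>
        m' = mem_of (memory (Suc k)) \<and> r' rFree = of_nat (length (memory (Suc k))) \<and>
        (0 < k \<longrightarrow> r' rC = leverrier_coeff A (k - 1)))" for k s
      show "wp G (Seq (For rK rN leverrier_step)
         (If (Eq rC rZero) (block [Const rN 0])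
           (block [Const rN 1]))) ((n * (step_time n + 2) + 2) + 2)
        (\<lambda>s. fst s 0 = (if det A = 0 then 0 else 1)) s"
        unfolding s
      proof (rule wp_SeqI)
        show "wp G (For rK rN leverrier_step) (n * (step_time n + 2) + 2) (I n) (r2,
          mem_of (memory 1))"
        proof (rule wp_For)
          show "I 0 (r2(rK := 0), mem_of (memory 1))"
            using env2 r2(1) by (simp add: I_def env_def)
          show "r' rK = of_nat k \<and> r' rN = of_nat n" if "I k (r', m')" for k r' m'
            using that by (simp add: I_def env_def)
          fix k r3 m3 assume k: "k < n" and I: "I k (r3, m3)" and G3: "numbers_in (r3, m3) \<subseteq> G"
          have "wp G leverrier_step (step_time n)
            (\<lambda>(r', m'). m' = mem_of (memory (Suc (Suc k))) \<and>
              r' rFree = of_nat (length (memory (Suc (Suc k)))) \<and>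
              r' rC = leverrier_coeff A k \<and>
              agree_off {rI, rJ, rL, rAcc, rX, rY, rT, rFree, rCur, rC} r3 r') (r3,
                mem_of (memory (Suc k)))"
            using I G3 k by (intro wp_leverrier_step) (auto simp: I_def env_def)
          moreover have "m3 = mem_of (memory (Suc k))" using I by (simp add: I_def)
          ultimately show "wp G leverrier_step (step_time n) (\<lambda>(r', m'). r' rK = of_nat k \<and>
            r' rOne = 1 \<and>
              I (Suc k) (r'(rK := of_nat (Suc k)), m')) (r3, m3)"
            using I by - (simp only:, erule wp_mono, auto simp: I_def env_def agree_off_def)
        qed (use G2 nat_n in auto)
        fix s assume I: "I n s" and G3: "numbers_in s \<subseteq> G"
        obtain r3 m3 where s: "s = (r3, m3)" by force
        have "leverrier_coeff A (n - 1) = 0 \<longleftrightarrow> det A = 0"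
          using n_pos by (intro leverrier_coeff_eq_0_iff) simp
        then have c: "r3 rC = r3 rZero \<longleftrightarrow> det A = 0" using I n_pos by (simp add: I_def s env_def)
        have "(0 :: rat) \<in> G" "(1 :: rat) \<in> G" using nat_n[of 0] nat_n[of 1] n_pos by simp_all
        then have "wp G (If (Eq rC rZero) (block [Const rN 0]) (block [Const rN 1])) (Suc 1)
          (\<lambda>s. fst s 0 = (if det A = 0 then 0 else 1)) (r3, m3)"
          using G3 c by (intro wp_If wp_blockI) (auto simp: s)
        then show "wp G (If (Eq rC rZero) (block [Const rN 0]) (block [Const rN 1])) 2
          (\<lambda>s. fst s 0 = (if det A = 0 then 0 else 1)) s"
          by (simp add: s numeral_2_eq_2)
      qed
    qed (use G1 r1 in \<open>auto simp: env_def\<close>)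
  qed
  then show ?thesis by (simp add: init total_time_def)
qed

end


section \<open>Encoding lengths\<close>

text \<open>
  \<open>Q\<close> is a denominator of \<open>y\<close>, not necessarily in lowest terms; so denominators of sums and
  products can be read off without cancellation.
\<close>

definition clears :: "nat \<Rightarrow> rat \<Rightarrow> bool" where
  "clears Q y \<longleftrightarrow> y * of_nat Q \<in> \<int>"

lemma clears_dvd: "clears Q y \<Longrightarrow> Q dvd Q' \<Longrightarrow> clears Q' y"
proof -
  assume "clears Q y" "Q dvd Q'"
  then obtain c where "Q' = Q * c" by blast
  then have "y * of_nat Q' = (y * of_nat Q) * of_nat c" by simp
  with \<open>clears Q y\<close> show ?thesis unfolding clears_def by (metis Ints_mult Ints_of_nat)
qed

lemma clears_add: "clears Q x \<Longrightarrow> clears Q y \<Longrightarrow> clears Q (x + y)"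
  by (simp add: clears_def distrib_right)

lemma clears_minus: "clears Q x \<Longrightarrow> clears Q (- x)"
  by (simp add: clears_def)

lemma clears_sum: "(\<And>i. i \<in> I \<Longrightarrow> clears Q (f i)) \<Longrightarrow> clears Q (sum f I)"
  by (simp add: clears_def sum_distrib_right Ints_sum)

lemma clears_mult: "clears Q x \<Longrightarrow> clears R y \<Longrightarrow> clears (Q * R) (x * y)"
proof -
  assume "clears Q x" "clears R y"
  moreover have "(x * y) * of_nat (Q * R) = (x * of_nat Q) * (y * of_nat R)" by simp
  ultimately show ?thesis unfolding clears_def by (metis Ints_mult)
qed

lemma clears_divide: "clears Q x \<Longrightarrow> k \<noteq> 0 \<Longrightarrow> clears (Q * k) (x / of_nat k)"
  by (simp add: clears_def)

lemma abs_sum_le: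
  "(\<And>i. i < m \<Longrightarrow> \<bar>f i\<bar> \<le> b) \<Longrightarrow> \<bar>\<Sum>i<m. f i\<bar> \<le> of_nat m * (b :: rat)"
proof -
  assume "\<And>i. i < m \<Longrightarrow> \<bar>f i\<bar> \<le> b"
  then have "(\<Sum>i<m. \<bar>f i\<bar>) \<le> of_nat (card {..<m}) * b" by (intro sum_bounded_above) simp
  then show ?thesis using order_trans[OF sum_abs[of f "{..<m}"]] by simp
qed

lemma less_power_floorlog: "x < 2 ^ floorlog 2 x"
  using floorlog_bounds[of x 2] by (cases "x = 0") (auto simp: floorlog_def)

lemma enc_length_bounds:
  shows "\<bar>q\<bar> \<le> 2 ^ enc_length q" "snd (quotient_of q) \<le> 2 ^ enc_length q"
    "clears (nat (snd (quotient_of q))) q" "0 < enc_length q"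
proof -
  obtain a b where q: "quotient_of q = (a, b)" by force
  have b: "0 < b" "q = of_int a / of_int b"
    using quotient_of_denom_pos[OF q] quotient_of_div[OF q] by auto
  have enc: "enc_length q = 1 + floorlog 2 (nat \<bar>a\<bar>) + floorlog 2 (nat b)"
    by (simp add: enc_length_def q)
  have "nat \<bar>a\<bar> < 2 ^ floorlog 2 (nat \<bar>a\<bar>)" "nat b < 2 ^ floorlog 2 (nat b)"
    by (rule less_power_floorlog)+
  moreover have "(2::nat) ^ floorlog 2 (nat \<bar>a\<bar>) \<le> 2 ^ enc_length q"
    "(2::nat) ^ floorlog 2 (nat b) \<le> 2 ^ enc_length q"
    unfolding enc by (intro power_increasing; simp)+
  ultimately have "nat \<bar>a\<bar> \<le> 2 ^ enc_length q" "nat b \<le> 2 ^ enc_length q" by linarith+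
  then have *: "\<bar>a\<bar> \<le> 2 ^ enc_length q" "b \<le> 2 ^ enc_length q"
    by (simp_all add: nat_le_iff)
  then show "snd (quotient_of q) \<le> 2 ^ enc_length q" by (simp add: q)
  have "\<bar>q\<bar> \<le> \<bar>q\<bar> * of_int b" using b(1) mult_left_mono[of 1 "of_int b" "\<bar>q\<bar>"] by simp
  also have "\<dots> = of_int \<bar>a\<bar>" using b by (simp add: abs_divide)
  also have "\<dots> \<le> of_int (2 ^ enc_length q)" using * by (subst of_int_le_iff)
  finally show "\<bar>q\<bar> \<le> 2 ^ enc_length q" by simp
  show "clears (nat (snd (quotient_of q))) q"
  proof -
    have "q * of_nat (nat b) = of_int a" using b by simp
    then show ?thesis by (simp add: clears_def q)
  qed
  show "0 < enc_length q" by (simp add: enc)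
qed

text \<open>
  Passing to lowest terms only shortens the numerator and the denominator: the reduced
  denominator divides \<open>Q\<close>.
\<close>

lemma enc_length_le:
  assumes "clears Q y" "0 < Q" "\<bar>y\<bar> \<le> of_nat V" "Q < 2 ^ u" "V * Q < 2 ^ v"
  shows "enc_length y \<le> 1 + v + u"
proof -
  obtain a b where q: "quotient_of y = (a, b)" by force
  have b: "0 < b" "y = of_int a / of_int b" and cop: "coprime a b"
    using quotient_of_denom_pos[OF q] quotient_of_div[OF q] quotient_of_coprime[OF q] by auto
  obtain z where "y * of_nat Q = of_int z" using assms(1) unfolding clears_def
    by (auto elim: Ints_cases)
  then have "of_int (a * int Q) = (of_int (z * b) :: rat)" using b by (simp add: field_simps)
  then have "a * int Q = z * b" unfolding of_int_eq_iff .
  then have "b dvd a * int Q" by simp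
  then have "b dvd int Q" using cop coprime_dvd_mult_right_iff[of b a]
    by (simp add: coprime_commute)
  then have bQ: "b \<le> int Q" using assms(2) by (intro zdvd_imp_le) auto
  have "of_int \<bar>a\<bar> = \<bar>y\<bar> * of_int b" using b by (simp add: abs_mult)
  also have "\<dots> \<le> of_nat V * of_nat Q"
    using assms(3) bQ b by (intro mult_mono) (auto simp: of_int_le_iff[of b "int Q",
      symmetric] simp del: of_int_le_iff)
  also have "\<dots> = of_int (int (V * Q))" by simp
  finally have "\<bar>a\<bar> \<le> int (V * Q)" unfolding of_int_le_iff .
  then have "nat \<bar>a\<bar> < 2 ^ v" "nat b < 2 ^ u" using bQ assms by linarith+
  then have "floorlog 2 (nat \<bar>a\<bar>) \<le> v" "floorlog 2 (nat b) \<le> u"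
    by (auto intro: floorlog_leI)
  then show ?thesis by (simp add: enc_length_def q)
qed

text \<open>
  The product, unlike the least common multiple, has an obvious number of bits: at most the sum
  of those of the factors.
\<close>

definition common_denom :: "rat list \<Rightarrow> nat" where
  "common_denom xs = prod_list (map (\<lambda>x. nat (snd (quotient_of x))) xs)"

lemma common_denom:
  shows "0 < common_denom xs" "common_denom xs \<le> 2 ^ sum_list (map enc_length xs)"
    "x \<in> set xs \<Longrightarrow> clears (common_denom xs) x"
    "x \<in> set xs \<Longrightarrow> \<bar>x\<bar> \<le> 2 ^ sum_list (map enc_length xs)"
    "length xs \<le> sum_list (map enc_length xs)"
proof (induction xs)
  case (Cons y xs)
  have y: "0 < nat (snd (quotient_of y))" "nat (snd (quotient_of y)) \<le> 2 ^ enc_length y"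
    using quotient_of_denom_pos'[of y] enc_length_bounds(2)[of y] by (simp_all add: nat_le_iff)
  { case 1 show ?case using Cons y by (simp add: common_denom_def) }
  { case 2 show ?case using Cons(2) y by (simp add: common_denom_def power_add mult_le_mono) }
  { case 3
    have "clears (nat (snd (quotient_of y))) y" by (rule enc_length_bounds)
    then show ?case using 3 Cons(3) by (auto simp: common_denom_def intro: clears_dvd) }
  { case 4
    have "\<bar>x\<bar> \<le> 2 ^ (enc_length y + sum_list (map enc_length xs))"
    proof (cases "x = y")
      case True
      have "\<bar>y\<bar> \<le> 2 ^ enc_length y" by (rule enc_length_bounds)
      also have "\<dots> \<le> 2 ^ (enc_length y + sum_list (map enc_length xs))"
        by (intro power_increasing) auto
      finally show ?thesis using True by simp
    next
      case False
      then have "\<bar>x\<bar> \<le> 2 ^ sum_list (map enc_length xs)" using 4 Cons(4) by simp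
      also have "\<dots> \<le> 2 ^ (enc_length y + sum_list (map enc_length xs))"
        by (intro power_increasing) auto
      finally show ?thesis .
    qed
    then show ?case by simp }
  { case 5 show ?case using Cons(5) enc_length_bounds(4)[of y] by simp }
qed (simp_all add: common_denom_def)

text \<open>
  Every step multiplies by one more entry of \<open>A\<close>, which contributes a factor \<open>E\<close>, and the
  division in \<open>c\<^sub>k\<close> contributes the factor \<open>k + 1\<close>.
\<close>

lemma leverrier_clears:
  assumes A: "A \<in> carrier_mat n n" and E: "\<And>i j. i < n \<Longrightarrow> j < n \<Longrightarrow> clears E (A $$ (i, j))"
  shows "i < n \<Longrightarrow> j < n \<Longrightarrow> clears (E ^ Suc k * fact k) (leverrier_mat A k $$ (i, j))"
    and "clears (E ^ Suc k * fact (Suc k)) (leverrier_coeff A k)"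
proof (induction k arbitrary: i j)
  case 0
  { case 1 then show ?case using E by simp }
  { case 2
    have "clears (E * Suc 0) (- (\<Sum>i<n. leverrier_mat A 0 $$ (i, i)) / of_nat (Suc 0))"
      by (intro clears_divide clears_minus clears_sum) (auto simp: E)
    then show ?case by (simp add: leverrier_coeff_eq[OF A]) }
next
  case (Suc k)
  have N: "clears (E ^ Suc (Suc k) * fact (Suc k)) (leverrier_mat A (Suc k) $$ (i, j))"
    if ij: "i < n" "j < n" for i j
    unfolding index_leverrier_mat_Suc[OF A ij]
  proof (intro clears_add clears_sum)
    fix l assume "l \<in> {..<n}"
    then have "clears (E * (E ^ Suc k * fact k)) (A $$ (i, l) * leverrier_mat A k $$ (l, j))"
      using ij by (intro clears_mult E Suc.IH) auto
    moreover have "E * (E ^ Suc k * fact k) dvd E ^ Suc (Suc k) * fact (Suc k)"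
      by (simp add: mult_ac fact_Suc)
    ultimately show "clears (E ^ Suc (Suc k) * fact (Suc k)) (A $$ (i,
      l) * leverrier_mat A k $$ (l, j))"
      by (rule clears_dvd)
  next
    have "clears ((E ^ Suc k * fact (Suc k)) * E) (leverrier_coeff A k * A $$ (i, j))"
      using ij by (intro clears_mult E Suc.IH)
    then show "clears (E ^ Suc (Suc k) * fact (Suc k)) (leverrier_coeff A k * A $$ (i, j))"
      by (rule clears_dvd) (simp add: mult_ac)
  qed
  { case 1 then show ?case by (rule N) }
  { case 2
    have "clears ((E ^ Suc (Suc k) * fact (Suc k)) * Suc (Suc k))
        (- (\<Sum>i<n. leverrier_mat A (Suc k) $$ (i, i)) / of_nat (Suc (Suc k)))"
      by (intro clears_divide clears_minus clears_sum N) simp_all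
    then show ?case unfolding leverrier_coeff_eq[OF A]
      by (rule clears_dvd) (simp only: fact_Suc[of "Suc k"] of_nat_id mult_ac dvd_refl) }
qed

text \<open>
  One step of the recursion enlarges the entries at most by the factor \<open>2 n b\<close>: the product
  \<open>A N\<^sub>k\<close> accounts for \<open>n b\<close>, and so does \<open>c\<^sub>k A\<close>, because a trace has \<open>n\<close> summands.
\<close>

definition growth :: "nat \<Rightarrow> rat \<Rightarrow> nat \<Rightarrow> rat" where
  "growth n b k = b * (2 * of_nat n * b) ^ k"

lemma abs_leverrier_le:
  assumes A: "A \<in> carrier_mat n n" and b: "\<And>i j. i < n \<Longrightarrow> j < n \<Longrightarrow> \<bar>A $$ (i, j)\<bar> \<le> b"
  shows "i < n \<Longrightarrow> j < n \<Longrightarrow> \<bar>leverrier_mat A k $$ (i, j)\<bar> \<le> growth n b k"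
    and "\<bar>leverrier_coeff A k\<bar> \<le> of_nat n * growth n b k"
proof -
  have coeff: "\<bar>leverrier_coeff A k\<bar> \<le> of_nat n * growth n b k"
    if "\<And>i j. i < n \<Longrightarrow> j < n \<Longrightarrow> \<bar>leverrier_mat A k $$ (i, j)\<bar> \<le> growth n b k" for k
  proof -
    have "\<bar>\<Sum>i<n. leverrier_mat A k $$ (i, i)\<bar> \<le> of_nat n * growth n b k"
      using that by (intro abs_sum_le) auto
    moreover have "\<bar>leverrier_coeff A k\<bar> \<le> \<bar>\<Sum>i<n. leverrier_mat A k $$ (i, i)\<bar>"
      by (simp add: leverrier_coeff_eq[OF A] abs_divide divide_le_eq mult_left_le_one_le mult_le_cancel_left1)
    ultimately show ?thesis by linarith
  qed
  have mat: "\<bar>leverrier_mat A k $$ (i, j)\<bar> \<le> growth n b k" if "i < n" "j < n" for i j k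
    using that
  proof (induction k arbitrary: i j)
    case 0
    then show ?case using b by (simp add: growth_def)
  next
    case (Suc k)
    have b0: "0 \<le> b" using b[OF Suc.prems] by linarith
    have "\<bar>\<Sum>l<n. A $$ (i, l) * leverrier_mat A k $$ (l, j)\<bar> \<le> of_nat n * (b * growth n b k)"
      unfolding abs_mult[symmetric] using Suc b b0
      by (intro abs_sum_le) (auto simp: abs_mult intro!: mult_mono)
    moreover have "\<bar>leverrier_coeff A k * A $$ (i, j)\<bar> \<le> (of_nat n * growth n b k) * b"
      unfolding abs_mult using Suc b b0
      by (intro mult_mono coeff mult_nonneg_nonneg) (auto simp: growth_def)
    ultimately show ?case unfolding index_leverrier_mat_Suc[OF A Suc.prems]
      by (simp add: growth_def algebra_simps)
  qed
  then show "i < n \<Longrightarrow> j < n \<Longrightarrow> \<bar>leverrier_mat A k $$ (i, j)\<bar> \<le> growth n b k" by blast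
  show "\<bar>leverrier_coeff A k\<bar> \<le> of_nat n * growth n b k" by (rule coeff) (rule mat)
qed

lemma set_coefficients:
  assumes "i \<le> j" "j < n" "k \<le> d"
  shows "coeff (P $$ (i, j)) k \<in> set (coefficients (n, d, P))"
  using nth_coefficients[OF assms, of P] nth_mem by metis

text \<open>
  \<open>D\<close> is a common denominator of the input, hence \<open>D\<^sup>2\<close> one of \<open>A\<close>.  The exponent exceeds that
  of \<open>leverrier_clears\<close> for \<open>c\<^bsub>n-1\<^esub>\<close> by one, which covers the products that are formed in the
  last step.
\<close>

definition denom_bound :: "nat \<Rightarrow> nat \<Rightarrow> nat" where
  "denom_bound D n = (D * D) ^ Suc n * fact n"

text \<open>
  The first summand is \<open>growth n b n\<close> with \<open>b = 2^(3 S)\<close>, where \<open>S\<close> is the encoding length of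
  the input: an entry of \<open>A\<close> is a sum of at most \<open>2^S\<close> products of two numbers of modulus at
  most \<open>2^S\<close>.  The second summand is for counters and addresses.
\<close>

definition value_bound :: "nat \<Rightarrow> nat \<Rightarrow> nat" where
  "value_bound S n = 2 ^ (3 * S) * (2 * n * 2 ^ (3 * S)) ^ n + (2 * S + n * n * (n + 1))"

lemma growth_mono:
  assumes "1 \<le> b" "1 \<le> n" "k \<le> k'"
  shows "growth n b k \<le> growth n b k'"
proof -
  have "1 * 1 \<le> 2 * of_nat n * b" using assms by (intro mult_mono) auto
  then show ?thesis unfolding growth_def using assms
    by (intro mult_left_mono power_increasing) auto
qed

lemma growth_Suc: "growth n b (Suc k) = 2 * of_nat n * b * growth n b k"
  by (simp add: growth_def)

text \<open>
  All numbers of step \<open>k < n\<close> obey the bounds for the entries of \<open>N\<^bsub>k+1\<^esub>\<close>, and these increase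
  with \<open>k\<close>. So the bounds for \<open>N\<^sub>n\<close> serve for the whole run.
\<close>

lemma kernel_run_bounded:
  assumes inst: "(n, d, P) \<in> sym_poly_matrices"
  defines "es \<equiv> coefficients (n, d, P)"
  defines "S \<equiv> sum_list (map enc_length es)"
  shows "kernel_run n d P {y. clears (denom_bound (common_denom es) n) y \<and>
    \<bar>y\<bar> \<le> of_nat (value_bound S n)}"
proof -
  define D where "D = common_denom es"
  define Q where "Q = denom_bound D n"
  define b :: rat where "b = 2 ^ (3 * S)"
  define G where "G = {y. clears Q y \<and> \<bar>y\<bar> \<le> of_nat (value_bound S n)}"
  let ?A = "sum_of_squares n d P"
  let ?N = "leverrier_mat ?A"
  have A: "?A \<in> carrier_mat n n" by simp
  have n: "1 \<le> n" and sym: "transpose_mat P = P" and P: "P \<in> carrier_mat n n"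
    using inst by (auto simp: sym_poly_matrices_def)
  have b1: "1 \<le> b" by (simp add: b_def)
  have V: "of_nat (value_bound S n) = growth n b n + of_nat (2 * S + n * n * (n + 1))"
    by (simp add: value_bound_def growth_def b_def)
  have D0: "D * D dvd Q"
    unfolding Q_def denom_bound_def by simp
  have in_G: "y \<in> G" if "clears E y" "E dvd Q" "\<bar>y\<bar> \<le> growth n b k" "k \<le> n" for y E k
  proof -
    have "\<bar>y\<bar> \<le> growth n b n" using that(3) growth_mono[OF b1 n that(4)] by linarith
    then have "\<bar>y\<bar> \<le> of_nat (value_bound S n)" unfolding V by (rule add_increasing2[rotated]) simp
    then show ?thesis using that clears_dvd by (auto simp: G_def)
  qed
  have len: "length es = (n + 1 choose 2) * Suc d" unfolding es_def length_coefficients by simp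
  have len_S: "length es \<le> S" unfolding S_def by (rule common_denom)
  have coeff: "clears D (coeff (P $$ (i, j)) k)" "\<bar>coeff (P $$ (i, j)) k\<bar> \<le> 2 ^ S"
    if "i < n" "j < n" "k \<le> d" for i j k
  proof -
    have "P $$ (i, j) = P $$ (j, i)" using arg_cong[OF sym, of "\<lambda>M. M $$ (i, j)"] that P by simp
    then have "coeff (P $$ (i, j)) k \<in> set es"
      using set_coefficients[of i j n k d P] set_coefficients[of j i n k d P] that
      unfolding es_def by (cases "i \<le> j") auto
    then show "clears D (coeff (P $$ (i, j)) k)" "\<bar>coeff (P $$ (i, j)) k\<bar> \<le> 2 ^ S"
      using common_denom(3,4)[of _ es] by (simp_all add: D_def S_def)
  qed
  define f where "f i j k l = coeff (P $$ (i, l)) k * coeff (P $$ (l, j)) k" for i j k l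
  have f_clears: "clears (D * D) (f i j k l)" if "i < n" "j < n" "k \<le> d" "l < n" for i j k l
    unfolding f_def using that by (intro clears_mult coeff)
  have f_le: "\<bar>f i j k l\<bar> \<le> 2 ^ (2 * S)" if "i < n" "j < n" "k \<le> d" "l < n" for i j k l
  proof -
    have "\<bar>f i j k l\<bar> \<le> 2 ^ S * 2 ^ S"
      unfolding f_def abs_mult using that by (intro mult_mono coeff) auto
    then show ?thesis by (simp add: mult_2 power_add)
  qed
  have nd_le: "n * Suc d \<le> length es"
  proof -
    have "2 * n \<le> (n + 1) * n" using n by (intro mult_le_mono1) simp
    then have "n \<le> n + 1 choose 2" unfolding choose_two by (simp add: less_eq_div_iff_mult_less_eq)
    then show ?thesis unfolding len by (rule mult_le_mono1)
  qed
  have sum_le: "\<bar>(\<Sum>k'<k. \<Sum>l'<n. f i j k' l') + (\<Sum>l'<l. f i j k l')\<bar> \<le> b"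
    and sum_clears: "clears (D * D) ((\<Sum>k'<k. \<Sum>l'<n. f i j k' l') + (\<Sum>l'<l. f i j k l'))"
    if "i < n" "j < n" "k \<le> d" "l \<le> n" for i j k l
  proof -
    have "\<bar>(\<Sum>k'<k. \<Sum>l'<n. f i j k' l') + (\<Sum>l'<l. f i j k l')\<bar> \<le>
        of_nat k * (of_nat n * 2 ^ (2 * S)) + of_nat l * 2 ^ (2 * S)"
      using that by (intro order_trans[OF abs_triangle_ineq] add_mono abs_sum_le f_le) auto
    also have "\<dots> = of_nat (k * n + l) * 2 ^ (2 * S)" by (simp add: algebra_simps)
    also have "\<dots> \<le> of_nat (2 ^ S) * 2 ^ (2 * S)"
    proof (intro mult_right_mono of_nat_mono)
      have "k * n + l \<le> d * n + n" using that by (intro add_mono mult_le_mono) auto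
      also have "\<dots> \<le> S" using nd_le len_S by (simp add: mult.commute)
      finally show "k * n + l \<le> 2 ^ S" using less_exp[of S] by linarith
    qed simp
    also have "\<dots> = b" by (simp add: b_def flip: power_add)
    finally show "\<bar>(\<Sum>k'<k. \<Sum>l'<n. f i j k' l') + (\<Sum>l'<l. f i j k l')\<bar> \<le> b" .
    show "clears (D * D) ((\<Sum>k'<k. \<Sum>l'<n. f i j k' l') + (\<Sum>l'<l. f i j k l'))"
      using that by (intro clears_add clears_sum f_clears) auto
  qed
  have A_eq: "?A $$ (i, j) = (\<Sum>k'<d. \<Sum>l'<n. f i j k' l') + (\<Sum>l'<n. f i j d l')"
    if "i < n" "j < n" for i j
    using that by (simp add: sum_of_squares_def f_def)
  have A_le: "\<bar>?A $$ (i, j)\<bar> \<le> b" and A_clears: "clears (D * D) (?A $$ (i, j))"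
    if "i < n" "j < n" for i j
    unfolding A_eq[OF that] using that by (intro sum_le sum_clears; simp)+
  note N_le = abs_leverrier_le[OF A A_le] and N_clears = leverrier_clears[OF A A_clears]
  have growth0: "0 \<le> growth n b k" for k using b1 by (simp add: growth_def)
  have growth_1: "growth n b 0 = b" by (simp add: growth_def)
  have nb: "of_nat n * growth n b k \<le> growth n b (Suc k)"
    "b * growth n b k \<le> growth n b (Suc k)"
    "of_nat n * growth n b k * b + of_nat n * (b * growth n b k) \<le> growth n b (Suc k)" for k
  proof -
    have "of_nat n * 1 * growth n b k \<le> (2 * of_nat n) * b * growth n b k"
      using b1 n growth0 by (intro mult_right_mono mult_mono) auto
    then show "of_nat n * growth n b k \<le> growth n b (Suc k)" by (simp add: growth_Suc)
    have "1 * b * growth n b k \<le> (2 * of_nat n) * b * growth n b k"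
      using b1 n growth0 by (intro mult_right_mono) auto
    then show "b * growth n b k \<le> growth n b (Suc k)" by (simp add: growth_Suc)
    show "of_nat n * growth n b k * b + of_nat n * (b * growth n b k) \<le> growth n b (Suc k)"
      by (simp add: growth_Suc)
  qed
  have dvd_Q: "(D * D) ^ i * fact j dvd Q" if "i \<le> Suc n" "j \<le> n" for i j
    unfolding Q_def denom_bound_def using that by (intro mult_dvd_mono le_imp_power_dvd fact_dvd)
  have dvd_Q': "(D * D) * ((D * D) ^ i * fact j) dvd Q" if "i \<le> n" "j \<le> n" for i j
    using dvd_Q[of "Suc i" j] that by (simp add: mult_ac)
  have "kernel_run n d P G"
  proof
    show "(n, d, P) \<in> sym_poly_matrices" by fact
    show "set (coefficients (n, d, P)) \<subseteq> G"
    proof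
      fix y assume "y \<in> set (coefficients (n, d, P))"
      then have y: "clears D y" "\<bar>y\<bar> \<le> 2 ^ S"
        using common_denom(3,4)[of y es] by (simp_all add: es_def D_def S_def)
      have "(2 :: rat) ^ S \<le> growth n b 0" unfolding growth_1 unfolding b_def
        by (rule power_increasing) auto
      then have "\<bar>y\<bar> \<le> growth n b 0" using y by linarith
      then show "y \<in> G" using y dvd_trans[OF _ D0, of D] by (intro in_G) auto
    qed
  next
    fix x assume "x \<le> 2 * length (coefficients (n, d, P)) + n * n * (n + 1)"
    then have "x \<le> value_bound S n"
      using len_S unfolding es_def value_bound_def by linarith
    then have "of_nat x \<le> (of_nat (value_bound S n) :: rat)" by (rule of_nat_mono)
    then show "of_nat x \<in> G" by (simp add: G_def clears_def Ints_mult Ints_of_nat)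
  next
    fix i j k l assume ij: "i < n" "j < n" "l < n" "k \<le> d"
    have "(2 :: rat) ^ (2 * S) \<le> growth n b 0" unfolding growth_1 unfolding b_def
      by (rule power_increasing) auto
    then have "\<bar>f i j k l\<bar> \<le> growth n b 0" using f_le[of i j k l] ij by linarith
    then have "f i j k l \<in> G" using ij D0 f_clears by (intro in_G) auto
    then show "coeff (P $$ (i, l)) k * coeff (P $$ (l, j)) k \<in> G" by (simp add: f_def)
  next
    fix i j k l assume ij: "i < n" "j < n" "l \<le> n" "k \<le> d"
    have "(\<Sum>k'<k. \<Sum>l'<n. f i j k' l') + (\<Sum>l'<l. f i j k l') \<in> G"
      using ij sum_le sum_clears D0 by (intro in_G[of "D * D" _ 0]) (auto simp: growth_1)
    then show "(\<Sum>k'<k. \<Sum>l'<n. coeff (P $$ (i, l')) k' * coeff (P $$ (l', j)) k') +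
      (\<Sum>l'<l. coeff (P $$ (i, l')) k * coeff (P $$ (l', j)) k) \<in> G" by (simp add: f_def)
  next
    fix k i assume ki: "k < n" "i \<le> n"
    have "\<bar>\<Sum>i'<i. ?N k $$ (i', i')\<bar> \<le> of_nat i * growth n b k"
      using ki by (intro abs_sum_le N_le) auto
    also have "\<dots> \<le> of_nat n * growth n b k" using ki growth0 by (intro mult_right_mono) auto
    also have "\<dots> \<le> growth n b (Suc k)" by (rule nb)
    finally show "(\<Sum>i'<i. ?N k $$ (i', i')) \<in> G"
      using ki by (intro in_G[of "(D * D) ^ Suc k * fact k" _ "Suc k"] clears_sum N_clears dvd_Q) auto
  next
    fix k assume k: "k < n"
    have *: "\<bar>leverrier_coeff ?A k\<bar> \<le> growth n b (Suc k)"
      using N_le(2)[of k] nb(1)[of k] by linarith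
    then show "leverrier_coeff ?A k \<in> G"
      using k by (intro in_G[of "(D * D) ^ Suc k * fact (Suc k)" _ "Suc k"] N_clears dvd_Q) auto
    show "- leverrier_coeff ?A k \<in> G"
      using k * by (intro in_G[of "(D * D) ^ Suc k * fact (Suc k)" _ "Suc k"] clears_minus N_clears dvd_Q) auto
  next
    fix i j k l assume ij: "i < n" "j < n" "l < n" "k < n"
    have "\<bar>?A $$ (i, l) * ?N k $$ (l, j)\<bar> \<le> b * growth n b k"
      unfolding abs_mult using ij b1 by (intro mult_mono A_le N_le) auto
    also have "\<dots> \<le> growth n b (Suc k)" by (rule nb)
    finally show "?A $$ (i, l) * ?N k $$ (l, j) \<in> G"
      using ij by (intro in_G[of "(D * D) * ((D * D) ^ Suc k * fact k)" _ "Suc k"]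
          clears_mult A_clears N_clears dvd_Q') auto
  next
    fix i j k l assume ij: "i < n" "j < n" "l \<le> n" "k < n"
    let ?s = "leverrier_coeff ?A k * ?A $$ (i, j) + (\<Sum>l'<l. ?A $$ (i, l') * ?N k $$ (l', j))"
    have "\<bar>\<Sum>l'<l. ?A $$ (i, l') * ?N k $$ (l', j)\<bar> \<le> of_nat l * (b * growth n b k)"
      unfolding abs_mult using ij b1
      by (intro abs_sum_le) (auto simp: abs_mult intro!: mult_mono A_le N_le)
    also have "\<dots> \<le> of_nat n * (b * growth n b k)"
      using ij b1 growth0 by (intro mult_right_mono) auto
    finally have "\<bar>\<Sum>l'<l. ?A $$ (i, l') * ?N k $$ (l', j)\<bar> \<le> of_nat n * (b * growth n b k)" .
    moreover have "\<bar>leverrier_coeff ?A k * ?A $$ (i, j)\<bar> \<le> of_nat n * growth n b k * b"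
      unfolding abs_mult using ij b1 growth0 by (intro mult_mono A_le N_le) auto
    ultimately have "\<bar>?s\<bar> \<le> growth n b (Suc k)" using nb(3)[of k] by linarith
    moreover have "clears ((D * D) * ((D * D) ^ Suc k * fact (Suc k))) ?s"
    proof (intro clears_add clears_sum)
      show "clears ((D * D) * ((D * D) ^ Suc k * fact (Suc k))) (leverrier_coeff ?A k * ?A $$ (i,
        j))"
        using ij clears_mult[OF A_clears N_clears(2), of i j k] by (simp only: mult.commute)
      fix l' assume "l' \<in> {..<l}"
      then have "clears ((D * D) * ((D * D) ^ Suc k * fact k)) (?A $$ (i, l') * ?N k $$ (l', j))"
        using ij by (intro clears_mult A_clears N_clears) auto
      then show "clears ((D * D) * ((D * D) ^ Suc k * fact (Suc k))) (?A $$ (i, l') * ?N k $$ (l',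
        j))"
        by (rule clears_dvd) (intro mult_dvd_mono fact_dvd; simp)
    qed
    ultimately show "?s \<in> G"
      using ij by (intro in_G[of "(D * D) * ((D * D) ^ Suc k * fact (Suc k))" _ "Suc k"] dvd_Q') auto
  qed
  then show ?thesis by (simp add: G_def Q_def D_def)
qed

lemma denom_bound_less:
  assumes "D \<le> 2 ^ S" "n \<le> S"
  shows "denom_bound D n \<le> 2 ^ (3 * S * S + 2 * S)"
proof -
  have "(D * D) ^ Suc n \<le> (2 ^ S * 2 ^ S) ^ Suc n"
    using assms by (intro power_mono mult_le_mono) auto
  also have "\<dots> = 2 ^ (2 * S * Suc n)" by (simp flip: power_add power_mult)
  finally have 1: "(D * D) ^ Suc n \<le> 2 ^ (2 * S * Suc n)" .
  have "fact n \<le> n ^ n" using fact_le_power[of n, where ?'a = nat] by simp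
  also have "\<dots> \<le> (2 ^ S) ^ n" using assms less_exp[of S] by (intro power_mono) linarith+
  also have "\<dots> = 2 ^ (S * n)" by (simp add: power_mult)
  finally have "denom_bound D n \<le> 2 ^ (2 * S * Suc n) * 2 ^ (S * n)"
    unfolding denom_bound_def by (rule mult_le_mono[OF 1])
  also have "\<dots> = 2 ^ (3 * (S * n) + 2 * S)" by (simp add: algebra_simps flip: power_add)
  also have "\<dots> \<le> 2 ^ (3 * S * S + 2 * S)" using assms by (intro power_increasing) auto
  finally show ?thesis .
qed

lemma value_bound_less:
  assumes "n \<le> S" "1 \<le> S"
  shows "value_bound S n \<le> 2 ^ (4 * S * S + 4 * S + 2)"
proof -
  have S: "S \<le> 2 ^ S" using less_exp[of S] by simp
  have "2 * n \<le> 2 * 2 ^ S" using assms S by linarith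
  then have "(2 * n * 2 ^ (3 * S)) ^ n \<le> (2 * 2 ^ S * 2 ^ (3 * S)) ^ n"
    by (intro power_mono mult_le_mono) auto
  also have "\<dots> = 2 ^ ((4 * S + 1) * n)"
  proof -
    have "2 * 2 ^ S * 2 ^ (3 * S) = (2 :: nat) ^ (4 * S + 1)" by (simp flip: power_add)
    then show ?thesis by (simp only: power_mult)
  qed
  also have "\<dots> \<le> 2 ^ ((4 * S + 1) * S)" using assms by (intro power_increasing mult_le_mono) auto
  finally have "2 ^ (3 * S) * (2 * n * 2 ^ (3 * S)) ^ n \<le> 2 ^ (3 * S) * 2 ^ ((4 * S + 1) * S)"
    by (rule mult_le_mono2)
  also have "\<dots> = 2 ^ (4 * S * S + 4 * S)" by (simp add: algebra_simps flip: power_add)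
  finally have 1: "2 ^ (3 * S) * (2 * n * 2 ^ (3 * S)) ^ n \<le> 2 ^ (4 * S * S + 4 * S)" .
  have "n * n * (n + 1) \<le> 2 ^ S * 2 ^ S * 2 ^ S"
    using assms less_exp[of S] by (intro mult_le_mono) linarith+
  also have "\<dots> = 2 ^ (3 * S)" by (simp flip: power_add)
  also have "\<dots> \<le> 2 ^ (4 * S * S + 4 * S)" by (intro power_increasing) auto
  finally have 2: "n * n * (n + 1) \<le> 2 ^ (4 * S * S + 4 * S)" .
  have "2 * S \<le> 2 ^ Suc S" using S by simp
  also have "\<dots> \<le> 2 ^ (4 * S * S + 4 * S)" using assms by (intro power_increasing) auto
  finally have "value_bound S n \<le> 3 * 2 ^ (4 * S * S + 4 * S)"
    unfolding value_bound_def using 1 2 by linarith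
  also have "\<dots> \<le> 2 ^ (4 * S * S + 4 * S + 2)" by (simp add: power_add)
  finally show ?thesis by simp
qed


section \<open>The decision algorithm\<close>

theorem lemma3p1:
  shows "\<exists>c. decides_in_strongly_polynomial_time c sym_poly_matrices sizes coefficients
           (\<lambda>(n, d, P). (\<Inter>t \<in> {-1..1::real}. mat_kernel (eval_poly_mat P t)) = {0\<^sub>v n})"
proof -
  define p :: "nat poly" where "p = total_time [:0, 1:] [:0, 1:]"
  define q :: "nat poly" where "q = [:8, 8, 10:]"
  have poly_p: "poly p L = total_time L L" for L
    by (simp add: p_def total_time_def square_time_def step_time_def)
  have poly_q: "poly q S = 8 + 8 * S + 10 * (S * S)" for S
    by (simp add: q_def algebra_simps)
  have "\<exists>ss s'. run kernel_program (initial_state (sizes x) (coefficients x)) ss s' \<and>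
      fst s' 0 = (if (case x of (n, d, P) \<Rightarrow>
        (\<Inter>t \<in> {-1..1::real}. mat_kernel (eval_poly_mat P t)) = {0\<^sub>v n}) then 1 else 0) \<and>
      length ss \<le> poly p (length (coefficients x)) \<and>
      (\<forall>s \<in> set ss \<union> {s'}. \<forall>y \<in> numbers_in s. enc_length y \<le>
        poly q (\<Sum>z\<leftarrow>coefficients x. enc_length z))"
    if x: "x \<in> sym_poly_matrices" for x
  proof -
    obtain n d P where [simp]: "x = (n, d, P)" by (cases x) auto
    define es where "es = coefficients (n, d, P)"
    define S where "S = sum_list (map enc_length es)"
    define Q where "Q = denom_bound (common_denom es) n"
    define V where "V = value_bound S n"
    interpret kernel_run n d P "{y. clears Q y \<and> \<bar>y\<bar> \<le> of_nat V}"
      unfolding Q_def V_def S_def es_def using x by (intro kernel_run_bounded) simp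
    have "n \<le> length es" unfolding es_def
      using len_eq mult_le_mono[OF mult_le_mono2[of 2 "n + 1" n], of 1 "Suc d"] n_pos by simp
    have len: "length es \<le> S" unfolding S_def by (rule common_denom)
    have nS: "n \<le> S" using \<open>n \<le> length es\<close> len by simp
    have "1 \<le> S" using nS n_pos by simp
    obtain ss s' where run: "run kernel_program (initial_state [n, d] es) ss s'"
      and time: "length ss \<le> total_time n (Suc d)"
      and result: "fst s' 0 = (if det A = 0 then 0 else 1)"
      and numbers: "\<forall>s \<in> set ss \<union> {s'}. numbers_in s \<subseteq> {y. clears Q y \<and> \<bar>y\<bar> \<le> of_nat V}"
      using wp_kernel_program unfolding wp_def es_def by blast
    have "total_time n (Suc d) \<le> total_time (length es) (length es)"
      unfolding total_time_def square_time_def step_time_def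
      using \<open>n \<le> length es\<close> small_le_len(3) by (intro add_mono mult_le_mono) (auto simp: es_def)
    then have "length ss \<le> poly p (length es)" unfolding poly_p using time by linarith
    moreover have enc: "enc_length y \<le> poly q S" if "clears Q y" "\<bar>y\<bar> \<le> of_nat V" for y
    proof -
      have Q: "Q \<le> 2 ^ (3 * S * S + 2 * S)"
        unfolding Q_def using nS common_denom(2)[of es]
          by (intro denom_bound_less) (auto simp: S_def)
      have V: "V \<le> 2 ^ (4 * S * S + 4 * S + 2)"
        unfolding V_def using nS \<open>1 \<le> S\<close> by (intro value_bound_less)
      have "enc_length y \<le> 1 + Suc ((4 * S * S + 4 * S + 2) + (3 * S * S + 2 * S)) + Suc (3 * S * S + 2 * S)"
      proof (rule enc_length_le[OF that(1) _ that(2)])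
        show "0 < Q" unfolding Q_def denom_bound_def using common_denom(1)[of es] by simp
        show "Q < 2 ^ Suc (3 * S * S + 2 * S)"
          by (rule le_less_trans[OF Q]) simp
        have "V * Q \<le> 2 ^ ((4 * S * S + 4 * S + 2) + (3 * S * S + 2 * S))"
          unfolding power_add[of _ "4 * S * S + 4 * S + 2"] by (rule mult_le_mono[OF V Q])
        also have "\<dots> < 2 ^ Suc ((4 * S * S + 4 * S + 2) + (3 * S * S + 2 * S))" by simp
        finally show "V * Q < 2 ^ Suc ((4 * S * S + 4 * S + 2) + (3 * S * S + 2 * S))" .
      qed
      then show ?thesis unfolding poly_q by (simp add: algebra_simps)
    qed
    moreover have "\<forall>s \<in> set ss \<union> {s'}. \<forall>y \<in> numbers_in s. enc_length y \<le> poly q S"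
      using numbers enc by blast
    moreover have "fst s' 0 = (if (\<Inter>t \<in> {-1..1::real}. mat_kernel (eval_poly_mat P t)) = {0\<^sub>v n} then 1 else 0)"
      unfolding common_kernel_trivial_iff[OF inst] using result by simp
    ultimately show ?thesis using run
      by (intro exI[of _ ss] exI[of _ s']) (simp add: es_def S_def)
  qed
  then show ?thesis
    unfolding decides_in_strongly_polynomial_time_def by blast
qed

end
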